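(* For every $\varepsilon\in(0,1/2)$, for $k:=\lceil 1/\varepsilon\rceil-2$, there exist: 1. a tree metric $(V,\mathrm{dist})$ (with a point set $P\subseteq V$) such that any $k$-center $\varepsilon$-coreset (for $P$) must have size at least $\frac{2^{1/\varepsilon}}{4}$; 2. a planar metric $(V,\mathrm{dist})$ (with a point set $P\subseteq V$) such that any $k$-center $\varepsilon$-coreset (for $P$) must have size at least $\frac{4^{1/\varepsilon}}{4}$.
   Context: A planar metric (respectively, tree metric) is the shortest-path metric on the vertex set of an edge-weighted planar graph (respectively, tree). For a set $X\subseteq V$, $\mathrm{dist}(v,X)=\min_{x\in X}\mathrm{dist}(v,x)$. Given a point set $P\subseteq V$, a $k$-center $\varepsilon$-coreset for $P$ is a subset $Q\subseteq P$ such that for every set $X\subseteq V$ of at most $k$ potential centers there exists $q\in Q$ with $\mathrm{dist}(q,X)\ge(1-\varepsilon)\max\{\mathrm{dist}(p,X): p\in P\}$. *)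

theory Defs
  imports "HOL-Analysis.Analysis" "Graph_Theory.Graph_Theory"
begin

text \<open>
  A finite simple undirected graph is a \<^locale>\<open>pair_graph\<close>: every undirected edge is a pair of
  opposite arcs. Weights are strictly positive and graphs connected, so that the shortest-path
  distance is a (finite) metric.
\<close>

definition edge_weighted_graph :: "'a pair_pre_digraph \<Rightarrow> ('a \<times> 'a) weight_fun \<Rightarrow> bool" where
  "edge_weighted_graph G w \<longleftrightarrow>
     pair_graph G \<and> Digraph_Component.connected (with_proj G) \<and>
     (\<forall>u v. (u, v) \<in> parcs G \<longrightarrow> w (u, v) > 0 \<and> w (v, u) = w (u, v))"

definition sp_dist :: "'a pair_pre_digraph \<Rightarrow> ('a \<times> 'a) weight_fun \<Rightarrow> 'a \<Rightarrow> 'a \<Rightarrow> real" where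
  "sp_dist G w u v = real_of_ereal (wf_digraph.\<mu> (with_proj G) w u v)"

text \<open>
  The constant \<open>tree\<close> of Graph_Theory cannot be used for symmetric digraphs: there the closed walk
  u, v, u along an edge and back counts as a cycle. In a simple graph the cycles of
  length at least 3 are exactly the undirected ones.
\<close>

definition tree_graph :: "'a pair_pre_digraph \<Rightarrow> bool" where
  "tree_graph G \<longleftrightarrow>
     pair_graph G \<and> Digraph_Component.connected (with_proj G) \<and>
     \<not> (\<exists>p. pre_digraph.cycle (with_proj G) p \<and> length p \<ge> 3)"

text \<open>
  A drawing places the vertices at distinct points of the plane and represents the edges by simple
  arcs that meet the vertices, and one another, only in common endpoints. The two arcs of an
  undirected edge are drawn as the same curve.
\<close>

definition plane_drawing ::
  "'a pair_pre_digraph \<Rightarrow> ('a \<Rightarrow> complex) \<Rightarrow> ('a \<times> 'a \<Rightarrow> real \<Rightarrow> complex) \<Rightarrow> bool" where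
  "plane_drawing G pos \<gamma> \<longleftrightarrow>
     inj_on pos (pverts G) \<and>
     (\<forall>u v. (u, v) \<in> parcs G \<longrightarrow>
        Path_Connected.arc (\<gamma> (u, v)) \<and>
        pathstart (\<gamma> (u, v)) = pos u \<and> pathfinish (\<gamma> (u, v)) = pos v \<and>
        \<gamma> (v, u) = reversepath (\<gamma> (u, v)) \<and>
        path_image (\<gamma> (u, v)) \<inter> pos ` pverts G \<subseteq> {pos u, pos v}) \<and>
     (\<forall>u v x y. (u, v) \<in> parcs G \<and> (x, y) \<in> parcs G \<and> {u, v} \<noteq> {x, y} \<longrightarrow>
        path_image (\<gamma> (u, v)) \<inter> path_image (\<gamma> (x, y)) \<subseteq> pos ` ({u, v} \<inter> {x, y}))"

definition planar_graph :: "'a pair_pre_digraph \<Rightarrow> bool" where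
  "planar_graph G \<longleftrightarrow> pair_graph G \<and> (\<exists>pos \<gamma>. plane_drawing G pos \<gamma>)"

definition tree_metric :: "'a set \<Rightarrow> ('a \<Rightarrow> 'a \<Rightarrow> real) \<Rightarrow> bool" where
  "tree_metric V d \<longleftrightarrow>
     (\<exists>G w. edge_weighted_graph G w \<and> tree_graph G \<and> pverts G = V \<and>
        (\<forall>u\<in>V. \<forall>v\<in>V. d u v = sp_dist G w u v))"

definition planar_metric :: "'a set \<Rightarrow> ('a \<Rightarrow> 'a \<Rightarrow> real) \<Rightarrow> bool" where
  "planar_metric V d \<longleftrightarrow>
     (\<exists>G w. edge_weighted_graph G w \<and> planar_graph G \<and> pverts G = V \<and>
        (\<forall>u\<in>V. \<forall>v\<in>V. d u v = sp_dist G w u v))"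

definition dist_to_set :: "('a \<Rightarrow> 'a \<Rightarrow> real) \<Rightarrow> 'a \<Rightarrow> 'a set \<Rightarrow> real" where
  "dist_to_set d v X = Min (d v ` X)"

text \<open>
  Meant for finite \<open>V\<close> and nonempty \<open>P \<subseteq> V\<close>, where the minima and maxima exist. Center sets are
  nonempty, as the distance to the empty set is not defined.
\<close>

definition kcenter_coreset ::
  "'a set \<Rightarrow> ('a \<Rightarrow> 'a \<Rightarrow> real) \<Rightarrow> nat \<Rightarrow> real \<Rightarrow> 'a set \<Rightarrow> 'a set \<Rightarrow> bool" where
  "kcenter_coreset V d k \<epsilon> P Q \<longleftrightarrow>
     Q \<subseteq> P \<and>
     (\<forall>X. X \<subseteq> V \<and> X \<noteq> {} \<and> card X \<le> k \<longrightarrow>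
        (\<exists>q\<in>Q. dist_to_set d q X \<ge> (1 - \<epsilon>) * Max ((\<lambda>p. dist_to_set d p X) ` P)))"

end

theory Submission
  imports Defs "HOL-Library.Code_Binary_Nat"
begin

text \<open>
  If D + 1 < 1 / \<epsilon> and some k centers lie within distance D of all points but p, while p is at
  distance at least D + 1 from them, then every coreset contains p. Point sets all of whose points
  are hard in this sense are grown step by step: to a point p that is supposed to end up with m + 1
  further levels below it one attaches a graph with B ports at distance 1 from p and, for every
  port, a center at distance at most D - m from the other ports but at least D - m + 1 from this
  one. This multiplies the number of points below p by B and costs one more center.

  A star with B = 2 ports gives the bound for trees. In the planar case the ports are one colour
  class of the cube graph, in which opposite vertices have distance 3 and other vertices of different
  colours distance 1, so B = 4. This alone only yields \<open>4 ^ k\<close> points, so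
  the first level uses better graphs: N points, each of which has an antipode at distance L among
  them while its distance to the others is at most A. With \<open>x = 1 / \<epsilon> - k\<close>, which lies in (1, 2], one
  needs A / (L - A) < x and \<open>4 powr x \<le> N\<close>, and for all x this holds for one of
  (N, A, L) = (8, 2, 4), (12, 6, 10), (14, 10, 16), (16, 22, 34).
  The first graph is the rhombic dodecahedron. The other three are subgraphs of duals of weighted arrangements of
  great circles, where the distance of two cells of the arrangement is the weight of the circles
  separating them; they were found by a computer search.
\<close>

section \<open>Walks and hard points\<close>

text \<open>Dropping p is fatal as soon as D < (1 - \<epsilon>) * (D + 1), that is, D + 1 < 1 /
  \<epsilon>; hence the gap 1. A port lies one unit away from the vertex that it replaces, so D has
  to grow by 1 with every center spent. Trees start from a single vertex without any center and D =
  k; since 1 / \<epsilon> \<le> k + 2, the resulting 2 ^ k points suffice. In the plane the goal is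
  4 powr (k - 1 + x), up to a factor 4 above 4 ^ k. The first graph spends one center; scaled by 1 /
  (L - A) its gap is 1 and D = k - 1 + A / (L - A), so D + 1 < 1 / \<epsilon> means A / (L - A) < x,
  and N * 4 ^ (k - 1) points are enough iff 4 powr x \<le> N. A great circle separates each cell
  from its antipode, so L is the total weight of the circles. Distances in the growing graph are
  never computed. The relation \<open>reach\<close> has the cost of a walk as an argument: an upper
  bound is an exhibited walk, a lower bound is a potential, and a walk in a glued graph projects to
  both parts. Edges are the pairs of positive weight.\<close>

inductive reach :: "('a \<Rightarrow> 'a \<Rightarrow> real) \<Rightarrow> 'a \<Rightarrow> 'a \<Rightarrow> real \<Rightarrow> bool" for W where
  reach_refl: "reach W u u 0"
| reach_step: "W u x > 0 \<Longrightarrow> reach W x v c \<Longrightarrow> reach W u v (W u x + c)"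

lemma reach_trans:
  assumes "reach W u v c" "reach W v x d"
  shows "reach W u x (c + d)"
  using assms
proof (induction rule: reach.induct)
  case (reach_step u y v c)
  then show ?case using reach.reach_step[of W u y x "c + d"] by (simp add: add.assoc)
qed simp

lemma reach_edge: "W u v > 0 \<Longrightarrow> reach W u v (W u v)"
  using reach_step[OF _ reach_refl, of W u v] by simp

lemma reach_nonneg: "reach W u v c \<Longrightarrow> 0 \<le> c"
  by (induction rule: reach.induct) auto

lemma reach_sym:
  assumes "\<And>u v. W u v = W v u" "reach W u v c"
  shows "reach W v u c"
  using assms(2)
proof (induction rule: reach.induct)
  case (reach_step u x v c)
  have "reach W x u (W u x)"
    using reach_edge[of W x u] reach_step(1) assms(1)[of u x] by metis
  from reach_trans[OF reach_step(3) this] show ?case by (simp add: add.commute)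
qed (rule reach_refl)

text \<open>The easy direction of linear-programming duality: \<phi> rises along an edge by at most
  its weight, so the rise telescopes along a walk. The lower bounds in the concrete graphs come from
  such potentials.\<close>

lemma reach_potential:
  assumes "\<And>u v. W u v > 0 \<Longrightarrow> \<phi> v \<le> \<phi> u + W u v" "reach W u v c"
  shows "\<phi> v - \<phi> u \<le> (c :: real)"
  using assms(2)
proof (induction rule: reach.induct)
  case (reach_step u x v c)
  then show ?case using assms(1)[of u x] by simp
qed simp

text \<open>Weights are a total function that vanishes off the edges, so that gluing two nets is
  pointwise addition and scaling is multiplication.\<close>

definition net :: "'a set \<Rightarrow> ('a \<Rightarrow> 'a \<Rightarrow> real) \<Rightarrow> bool" where
  "net V W \<longleftrightarrow> finite V \<and> V \<noteq> {} \<and> (\<forall>u v. W u v = W v u \<and> 0 \<le> W u v) \<and>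
     (\<forall>u v. W u v \<noteq> 0 \<longrightarrow> u \<in> V \<and> v \<in> V \<and> u \<noteq> v) \<and>
     (\<forall>u\<in>V. \<forall>v\<in>V. \<exists>c. reach W u v c)"

lemma netD:
  assumes "net V W"
  shows "finite V" "V \<noteq> {}" "W u v = W v u" "0 \<le> W u v" "W u v > 0 \<Longrightarrow> u \<in> V"
    "W u v > 0 \<Longrightarrow> v \<in> V" "W u u = 0" "u \<notin> V \<Longrightarrow> W u v = 0" "v \<notin> V \<Longrightarrow> W u v = 0"
    "u \<in> V \<Longrightarrow> v \<in> V \<Longrightarrow> \<exists>c. reach W u v c"
proof -
  note * = assms[unfolded net_def]
  show "finite V" "V \<noteq> {}" "W u v = W v u" "0 \<le> W u v"
    "u \<in> V \<Longrightarrow> v \<in> V \<Longrightarrow> \<exists>c. reach W u v c"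
    using * by blast+
  show "W u v > 0 \<Longrightarrow> u \<in> V" "W u v > 0 \<Longrightarrow> v \<in> V" "W u u = 0"
    "u \<notin> V \<Longrightarrow> W u v = 0" "v \<notin> V \<Longrightarrow> W u v = 0"
    using * by (metis less_irrefl)+
qed

section \<open>The graph of a weight function and its shortest-path distance\<close>

definition graph_of :: "'a set \<Rightarrow> ('a \<Rightarrow> 'a \<Rightarrow> real) \<Rightarrow> 'a pair_pre_digraph" where
  "graph_of V W = \<lparr>pverts = V, parcs = {(u, v). W u v > 0}\<rparr>"

lemma graph_of_simps [simp]:
  "pverts (graph_of V W) = V" "parcs (graph_of V W) = {(u, v). W u v > 0}"
  by (simp_all add: graph_of_def)

context
  fixes V :: "'a set" and W :: "'a \<Rightarrow> 'a \<Rightarrow> real"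
  assumes net: "net V W"
begin

lemma pair_graph_of: "pair_graph (graph_of V W)"
proof
  have "parcs (graph_of V W) \<subseteq> V \<times> V"
    using netD(5,6)[OF net] by auto
  then show "finite (parcs (graph_of V W))"
    using netD(1)[OF net] by (auto intro: finite_subset)
  show "symmetric (with_proj (graph_of V W))"
    unfolding symmetric_def by (auto simp: sym_def netD(3)[OF net])
  show "fst e \<noteq> snd e" if "e \<in> parcs (graph_of V W)" for e
    using that netD(7)[OF net] by (cases e) auto
  show "fst e \<in> pverts (graph_of V W)" "snd e \<in> pverts (graph_of V W)"
    if "e \<in> parcs (graph_of V W)" for e
    using that netD(5,6)[OF net, of "fst e" "snd e"] by auto
qed (use netD(1)[OF net] in simp)

interpretation pair_graph "graph_of V W"
  by (rule pair_graph_of)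

lemma awalk_reach:
  "awalk u p v \<Longrightarrow> reach W u v (awalk_cost (\<lambda>(x, y). W x y) p)"
proof (induction p arbitrary: u)
  case Nil
  then show ?case by (auto simp: awalk_Nil_iff intro: reach_refl)
next
  case (Cons e p)
  then obtain x where e: "e = (u, x)" "W u x > 0" "awalk x p v"
    by (cases e) (auto simp: awalk_Cons_iff)
  show ?case using reach_step[OF e(2) Cons.IH[OF e(3)]] unfolding e(1) by simp
qed

lemma reach_awalk:
  "reach W u v c \<Longrightarrow> v \<in> V \<Longrightarrow> \<exists>p. awalk u p v \<and> awalk_cost (\<lambda>(x, y). W x y) p = c"
proof (induction rule: reach.induct)
  case (reach_refl u)
  then have "awalk u [] u" "awalk_cost (\<lambda>(x, y). W x y) [] = 0"
    by (simp_all add: awalk_Nil_iff)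
  then show ?case by blast
next
  case (reach_step u x v c)
  then obtain p where "awalk x p v" "awalk_cost (\<lambda>(x, y). W x y) p = c" by auto
  moreover have "u \<in> V" using netD(5)[OF net reach_step(1)] .
  ultimately have "awalk u ((u, x) # p) v" "awalk_cost (\<lambda>(x, y). W x y) ((u, x) # p) = W u x + c"
    using reach_step(1) by (simp_all add: awalk_Cons_iff)
  then show ?case by blast
qed

lemma
  assumes "u \<in> V" "v \<in> V"
  shows sp_dist_le: "reach W u v c \<Longrightarrow> sp_dist (graph_of V W) (\<lambda>(x, y). W x y) u v \<le> c"
    and sp_dist_ge: "(\<And>c. reach W u v c \<Longrightarrow> b \<le> c) \<Longrightarrow>
      b \<le> sp_dist (graph_of V W) (\<lambda>(x, y). W x y) u v"
proof -
  let ?m = "\<mu> (\<lambda>(x, y). W x y) u v"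
  have le: "?m \<le> ereal c" if "reach W u v c" for c
    using reach_awalk[OF that assms(2)] min_cost_le_walk_cost by metis
  have ge: "ereal b \<le> ?m" if "\<And>c. reach W u v c \<Longrightarrow> b \<le> c" for b
    unfolding \<mu>_def using that awalk_reach by (auto intro!: INF_greatest)
  \<comment> \<open>The minimum cost is an extended real; one walk bounds it from above and
    nonnegativity from below, so \<open>real_of_ereal\<close> loses nothing.\<close>
  obtain c0 where "reach W u v c0"
    using netD(10)[OF net assms] by blast
  then have fin: "\<bar>?m\<bar> \<noteq> \<infinity>"
    using le[of c0] ge[of 0] reach_nonneg[of W u v] by (cases ?m) auto
  have r: "ereal (sp_dist (graph_of V W) (\<lambda>(x, y). W x y) u v) = ?m"
    unfolding sp_dist_def using fin by (simp add: ereal_real)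
  show "reach W u v c \<Longrightarrow> sp_dist (graph_of V W) (\<lambda>(x, y). W x y) u v \<le> c" for c
    using le[of c] r by (metis ereal_less_eq(3))
  show "(\<And>c. reach W u v c \<Longrightarrow> b \<le> c) \<Longrightarrow> b \<le> sp_dist (graph_of V W) (\<lambda>(x, y). W x y) u v"
    using ge[of b] r by (metis ereal_less_eq(3))
qed

lemma connected_graph_of: "Digraph_Component.connected (with_proj (graph_of V W))"
proof (rule connectedI)
  show "pverts (graph_of V W) \<noteq> {}"
    using netD(2)[OF net] by simp
next
  fix u v assume "u \<in> pverts (graph_of V W)" "v \<in> pverts (graph_of V W)"
  then obtain c where "reach W u v c" "v \<in> V" using netD(10)[OF net] by auto
  then have "u \<rightarrow>\<^sup>*\<^bsub>with_proj (graph_of V W)\<^esub> v"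
    using reach_awalk reachable_awalk by metis
  then show "u \<rightarrow>\<^sup>*\<^bsub>mk_symmetric (with_proj (graph_of V W))\<^esub> v"
    by (rule reachable_mk_symmetricI)
qed

lemma edge_weighted_graph_of: "edge_weighted_graph (graph_of V W) (\<lambda>(x, y). W x y)"
  using pair_graph_of connected_graph_of netD(3)[OF net] by (simp add: edge_weighted_graph_def)

end

text \<open>
  The set X shows that p cannot be dropped from a coreset. The summands h anticipate that p will be
  replaced by points at distance h p from it.
\<close>

definition hard_points ::
  "'a set \<Rightarrow> ('a \<Rightarrow> 'a \<Rightarrow> real) \<Rightarrow> 'a set \<Rightarrow> ('a \<Rightarrow> nat) \<Rightarrow> nat \<Rightarrow> real \<Rightarrow> bool" where
  "hard_points V W P h k D \<longleftrightarrow> P \<subseteq> V \<and> (\<forall>p\<in>P. \<exists>X\<subseteq>V. card X + h p \<le> k \<and>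
     (\<forall>x\<in>X. \<forall>c. reach W p x c \<longrightarrow> D + 1 \<le> c + real (h p)) \<and>
     (\<forall>q\<in>P - {p}. \<exists>x\<in>X. \<exists>c. reach W q x c \<and> c + real (h q) \<le> D))"

text \<open>A coreset that misses p fails on the center set X of p: all its points are within D of X
  while p is at least D + 1 away, so the coreset inequality would give (1 - \<epsilon>) * (D + 1)
  \<le> D, against D + 1 < 1 / \<epsilon>.\<close>

lemma coreset_eq_if_hard_points:
  assumes net: "net V W" and hard: "hard_points V W P h k D"
    and h: "\<And>p. p \<in> P \<Longrightarrow> h p = 0" and "2 \<le> card P"
    and \<epsilon>: "0 < \<epsilon>" "\<epsilon> < 1" "D + 1 < 1 / \<epsilon>"
    and Q: "kcenter_coreset V (sp_dist (graph_of V W) (\<lambda>(x, y). W x y)) k \<epsilon> P Q"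
  shows "Q = P"
proof -
  let ?d = "sp_dist (graph_of V W) (\<lambda>(x, y). W x y)"
  have fin: "finite V" and PV: "P \<subseteq> V" and "finite P"
    using netD(1)[OF net] hard finite_subset unfolding hard_points_def by auto
  have "p \<in> Q" if "p \<in> P" for p
  proof (rule ccontr)
    assume "p \<notin> Q"
    obtain X where X: "X \<subseteq> V" "card X \<le> k"
      and far: "\<And>x c. x \<in> X \<Longrightarrow> reach W p x c \<Longrightarrow> D + 1 \<le> c"
      and near: "\<And>q. q \<in> P - {p} \<Longrightarrow> \<exists>x\<in>X. \<exists>c. reach W q x c \<and> c \<le> D"
    proof -
      obtain X where "X \<subseteq> V" "card X + h p \<le> k"
        "\<forall>x\<in>X. \<forall>c. reach W p x c \<longrightarrow> D + 1 \<le> c + real (h p)"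
        "\<forall>q\<in>P - {p}. \<exists>x\<in>X. \<exists>c. reach W q x c \<and> c + real (h q) \<le> D"
        using hard \<open>p \<in> P\<close> unfolding hard_points_def by blast
      then show thesis using h \<open>p \<in> P\<close> by (intro that[of X]) (auto simp: h)
    qed
    \<comment> \<open>A second point must lie near some center, which makes X nonempty and hence an
      admissible center set.\<close>
    have "card (P - {p}) \<noteq> 0"
      using \<open>2 \<le> card P\<close> \<open>p \<in> P\<close> by simp
    then have "P - {p} \<noteq> {}" by fastforce
    then have "X \<noteq> {}" using near by blast
    have finX: "finite X" using X(1) fin finite_subset by blast
    then obtain q where q: "q \<in> Q"
      "(1 - \<epsilon>) * Max ((\<lambda>p. dist_to_set ?d p X) ` P) \<le> dist_to_set ?d q X"
      using Q X \<open>X \<noteq> {}\<close> unfolding kcenter_coreset_def by blast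
    have qP: "q \<in> P - {p}" using q(1) \<open>p \<notin> Q\<close> Q unfolding kcenter_coreset_def by auto
    obtain x c where x: "x \<in> X" "reach W q x c" "c \<le> D" using near[OF qP] by blast
    then have "?d q x \<le> D"
      using sp_dist_le[OF net, of q x c] qP PV X(1) by force
    then have 1: "dist_to_set ?d q X \<le> D"
      unfolding dist_to_set_def using finX x(1) by (meson Min_le finite_imageI image_eqI order_trans)
    have "D + 1 \<le> ?d p y" if "y \<in> X" for y
      using sp_dist_ge[OF net, of p y "D + 1"] far[OF that] \<open>p \<in> P\<close> PV X(1) that by auto
    then have "D + 1 \<le> dist_to_set ?d p X"
      unfolding dist_to_set_def using finX \<open>X \<noteq> {}\<close> by simp
    also have "\<dots> \<le> Max ((\<lambda>p. dist_to_set ?d p X) ` P)"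
      using \<open>finite P\<close> \<open>p \<in> P\<close> by simp
    finally have "(1 - \<epsilon>) * (D + 1) \<le> (1 - \<epsilon>) * \<dots>"
      using \<epsilon> by (intro mult_left_mono) auto
    then have "(1 - \<epsilon>) * (D + 1) \<le> D"
      using q(2) 1 by linarith
    then have "1 \<le> \<epsilon> * (D + 1)" by (simp add: algebra_simps)
    then show False using \<epsilon> by (simp add: field_simps)
  qed
  then show ?thesis using Q unfolding kcenter_coreset_def by auto
qed

section \<open>Gluing at a vertex\<close>

definition glue :: "('a \<Rightarrow> 'a \<Rightarrow> real) \<Rightarrow> ('a \<Rightarrow> 'a \<Rightarrow> real) \<Rightarrow> 'a \<Rightarrow> 'a \<Rightarrow> real" where
  "glue W W' u v = W u v + W' u v"

lemma glue_pos: "net V W \<Longrightarrow> net V' W' \<Longrightarrow> glue W W' u v > 0 \<longleftrightarrow> W u v > 0 \<or> W' u v > 0"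
  unfolding glue_def using netD(4)[of V W u v] netD(4)[of V' W' u v] by linarith

context
  fixes V V' :: "'a set" and W W' :: "'a \<Rightarrow> 'a \<Rightarrow> real" and p :: 'a
  assumes net: "net V W" and net': "net V' W'" and common: "V \<inter> V' = {p}"
begin

text \<open>An edge of both nets would have both ends in V \<inter> V' = {p} and be a loop, so at
  most one summand is nonzero.\<close>

lemma glue_left: "W u v > 0 \<Longrightarrow> glue W W' u v = W u v"
  and glue_right: "W' u v > 0 \<Longrightarrow> glue W W' u v = W' u v"
proof -
  have "W u v = 0 \<or> W' u v = 0"
  proof (rule ccontr)
    assume "\<not> ?thesis"
    then have "W u v > 0" "W' u v > 0"
      using netD(4)[OF net, of u v] netD(4)[OF net', of u v] by auto
    then have "u = p" "v = p"
      using netD(5,6)[OF net] netD(5,6)[OF net'] common by blast+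
    then show False using \<open>W u v > 0\<close> netD(7)[OF net] by simp
  qed
  then show "W u v > 0 \<Longrightarrow> glue W W' u v = W u v" "W' u v > 0 \<Longrightarrow> glue W W' u v = W' u v"
    unfolding glue_def by auto
qed

lemma reach_glue_left: "reach W u v c \<Longrightarrow> reach (glue W W') u v c"
proof (induction rule: reach.induct)
  case (reach_step u x v c)
  then show ?case using reach.reach_step[of "glue W W'" u x v c] glue_left[of u x] by simp
qed (rule reach_refl)

lemma reach_glue_right: "reach W' u v c \<Longrightarrow> reach (glue W W') u v c"
proof (induction rule: reach.induct)
  case (reach_step u x v c)
  then show ?case using reach.reach_step[of "glue W W'" u x v c] glue_right[of u x] by simp
qed (rule reach_refl)

text \<open>Collapsing either part to the common vertex splits a walk into one walk in each part.\<close>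

lemma reach_glueD:
  assumes "reach (glue W W') u v c"
  obtains a b where "a + b = c"
    "reach W (if u \<in> V then u else p) (if v \<in> V then v else p) a"
    "reach W' (if u \<in> V' then u else p) (if v \<in> V' then v else p) b"
proof -
  let ?f = "\<lambda>u. if u \<in> V then u else p" and ?g = "\<lambda>u. if u \<in> V' then u else p"
  from assms have "\<exists>a b. a + b = c \<and> reach W (?f u) (?f v) a \<and> reach W' (?g u) (?g v) b"
  proof (induction rule: reach.induct)
    case (reach_refl u)
    then show ?case by (intro exI[of _ 0]) (auto intro: reach.reach_refl)
  next
    case (reach_step u x v c)
    then obtain a b where ab: "a + b = c" "reach W (?f x) (?f v) a" "reach W' (?g x) (?g v) b"
      by auto
    consider "W u x > 0" | "W' u x > 0" using reach_step(1) glue_pos[OF net net'] by blast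
    then show ?case
    proof cases
      case 1
      then have V: "u \<in> V" "x \<in> V" using netD(5,6)[OF net] by blast+
      then have "?g u = p" "?g x = p" using common by auto
      moreover have "reach W (?f u) (?f v) (glue W W' u x + a)"
        using ab(2) V reach.reach_step[of W u x "?f v" a, OF 1] glue_left[OF 1] by simp
      ultimately show ?thesis using ab by (intro exI[of _ "glue W W' u x + a"] exI[of _ b]) simp
    next
      case 2
      then have V: "u \<in> V'" "x \<in> V'" using netD(5,6)[OF net'] by blast+
      then have "?f u = p" "?f x = p" using common by auto
      moreover have "reach W' (?g u) (?g v) (glue W W' u x + b)"
        using ab(3) V reach.reach_step[of W' u x "?g v" b, OF 2] glue_right[OF 2] by simp
      ultimately show ?thesis using ab by (intro exI[of _ a] exI[of _ "glue W W' u x + b"]) simp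
    qed
  qed
  then show ?thesis using that by blast
qed

lemma net_glue: "net (V \<union> V') (glue W W')"
  unfolding net_def
proof (intro conjI allI impI ballI)
  show "finite (V \<union> V')" "V \<union> V' \<noteq> {}"
    using netD(1,2)[OF net] netD(1)[OF net'] by auto
  fix u v
  show "glue W W' u v = glue W W' v u" "0 \<le> glue W W' u v"
    unfolding glue_def using netD(3,4)[OF net] netD(3,4)[OF net'] by (metis, metis add_nonneg_nonneg)
  show "u \<in> V \<union> V'" "v \<in> V \<union> V'" "u \<noteq> v" if "glue W W' u v \<noteq> 0"
  proof -
    have "0 < glue W W' u v" using that \<open>0 \<le> glue W W' u v\<close> by simp
    then have "W u v > 0 \<or> W' u v > 0" using glue_pos[OF net net'] by blast
    then show "u \<in> V \<union> V'" "v \<in> V \<union> V'" "u \<noteq> v"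
      using netD(5-7)[OF net] netD(5-7)[OF net'] by (blast, blast, force)
  qed
next
  have p: "p \<in> V" "p \<in> V'" using common by auto
  have to_p: "\<exists>c. reach (glue W W') u p c" if "u \<in> V \<union> V'" for u
    using that netD(10)[OF net _ p(1), of u] netD(10)[OF net' _ p(2), of u]
      reach_glue_left reach_glue_right by blast
  have from_p: "\<exists>c. reach (glue W W') p u c" if "u \<in> V \<union> V'" for u
    using that netD(10)[OF net p(1), of u] netD(10)[OF net' p(2), of u]
      reach_glue_left reach_glue_right by blast
  show "\<exists>c. reach (glue W W') u v c" if "u \<in> V \<union> V'" "v \<in> V \<union> V'" for u v
    using to_p[OF that(1)] from_p[OF that(2)] reach_trans by metis
qed

end

text \<open>
  The ports S are to replace the root r as hard points; the center z s is far from the port s only.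
\<close>

definition splitter ::
  "'a set \<Rightarrow> ('a \<Rightarrow> 'a \<Rightarrow> real) \<Rightarrow> 'a \<Rightarrow> 'a set \<Rightarrow> ('a \<Rightarrow> 'a) \<Rightarrow> real \<Rightarrow> bool" where
  "splitter V W r S z a \<longleftrightarrow> net V W \<and> r \<in> V \<and> S \<subseteq> V - {r} \<and> z ` S \<subseteq> V \<and>
     (\<forall>s\<in>S. (\<exists>c\<le>1. reach W s r c) \<and> (\<forall>c. reach W s r c \<longrightarrow> 1 \<le> c)) \<and>
     (\<forall>s\<in>S. (\<forall>c. reach W s (z s) c \<longrightarrow> a + 1 \<le> c) \<and>
        (\<forall>s'\<in>S - {s}. \<exists>c\<le>a. reach W s' (z s) c))"

text \<open>The accounts balance. A port s takes over the center set of p and adds z s; the drop of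
  h from m + 1 to m pays for this center. A walk from s to an old center passes through p and is
  longer by at least 1, which makes up for the smaller h in the bound D + 1.\<close>

lemma hard_points_glue_splitter:
  assumes net: "net V W" and hard: "hard_points V W P h k D"
    and p: "p \<in> P" "h p = Suc m"
    and sp: "splitter V' W' p S z (D - real m)" and common: "V \<inter> V' = {p}"
  shows "hard_points (V \<union> V') (glue W W') (P - {p} \<union> S) (\<lambda>q. if q \<in> S then m else h q) k D"
  unfolding hard_points_def
proof (intro conjI ballI)
  have net': "net V' W'" using sp unfolding splitter_def by blast
  note l = reach_glue_left[OF net net' common] and r = reach_glue_right[OF net net' common]
    and dec = reach_glueD[OF net net' common]
  let ?h = "\<lambda>q. if q \<in> S then m else h q" and ?W = "glue W W'"
  have PV: "P \<subseteq> V" using hard unfolding hard_points_def by blast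
  have S: "S \<subseteq> V' - {p}" and zS: "z ` S \<subseteq> V'" using sp unfolding splitter_def by blast+
  then have SV: "S \<inter> V = {}" using common by blast
  show "P - {p} \<union> S \<subseteq> V \<union> V'" using PV S by blast
  have pV: "p \<in> V" "p \<in> V'" using common by auto
  obtain X where X: "X \<subseteq> V" "card X + Suc m \<le> k"
    "\<And>x c. x \<in> X \<Longrightarrow> reach W p x c \<Longrightarrow> D + 1 \<le> c + real (Suc m)"
    "\<And>q. q \<in> P - {p} \<Longrightarrow> \<exists>x\<in>X. \<exists>c. reach W q x c \<and> c + real (h q) \<le> D"
    using hard p unfolding hard_points_def by metis
  \<comment> \<open>Compared with p, a port is at most 1 farther from an old center and its h is 1
    smaller, so a center near enough to p is near enough to the ports.\<close>
  have old: "\<exists>x\<in>Y. \<exists>c. reach ?W q' x c \<and> c + real (?h q') \<le> D"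
    if Y: "\<And>q. q \<in> P - {t} \<Longrightarrow> \<exists>x\<in>Y. \<exists>c. reach W q x c \<and> c + real (h q) \<le> D"
      and "t \<in> P" "t \<noteq> p" and q': "q' \<in> P - {p} \<union> S" "q' \<noteq> t" for Y t q'
  proof (cases "q' \<in> S")
    case False
    then show ?thesis using Y[of q'] q' l by fastforce
  next
    case True
    then obtain c where c: "c \<le> 1" "reach W' q' p c" using sp unfolding splitter_def by blast
    obtain x d where x: "x \<in> Y" "reach W p x d" "d + real (Suc m) \<le> D"
      using Y[of p] p \<open>t \<noteq> p\<close> by auto
    have "reach ?W q' x (c + d)" using reach_trans[OF r[OF c(2)] l[OF x(2)]] .
    then show ?thesis using x c(1) True by (intro bexI[of _ x] exI[of _ "c + d"]) auto
  qed
  fix q assume q: "q \<in> P - {p} \<union> S"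
  show "\<exists>X\<subseteq>V \<union> V'. card X + ?h q \<le> k \<and>
     (\<forall>x\<in>X. \<forall>c. reach ?W q x c \<longrightarrow> D + 1 \<le> c + real (?h q)) \<and>
     (\<forall>q'\<in>P - {p} \<union> S - {q}. \<exists>x\<in>X. \<exists>c. reach ?W q' x c \<and> c + real (?h q') \<le> D)"
  proof (cases "q \<in> S")
    case False
    then have qP: "q \<in> P" "q \<noteq> p" "q \<in> V" using q PV by auto
    then obtain Y where Y: "Y \<subseteq> V" "card Y + h q \<le> k"
      "\<And>x c. x \<in> Y \<Longrightarrow> reach W q x c \<Longrightarrow> D + 1 \<le> c + real (h q)"
      "\<And>q'. q' \<in> P - {q} \<Longrightarrow> \<exists>x\<in>Y. \<exists>c. reach W q' x c \<and> c + real (h q') \<le> D"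
      using hard unfolding hard_points_def by metis
    have "D + 1 \<le> c + real (h q)" if x: "x \<in> Y" and c: "reach ?W q x c" for x c
    proof -
      obtain a b where ab: "a + b = c" "reach W (if q \<in> V then q else p) (if x \<in> V then x else p) a"
        "reach W' (if q \<in> V' then q else p) (if x \<in> V' then x else p) b"
        by (rule dec[OF c])
      have "x \<in> V" using x Y(1) by blast
      then have "D + 1 \<le> a + real (h q)" using Y(3)[OF x, of a] ab(2) qP(3) by simp
      then show ?thesis using ab(1) reach_nonneg[OF ab(3)] by linarith
    qed
    then show ?thesis using Y old[OF Y(4) qP(1,2)] False
      by (intro exI[of _ Y]) auto
  next
    case True
    let ?Y = "insert (z q) X"
    have finX: "finite X" using X(1) netD(1)[OF net] finite_subset by blast
    have far: "D + 1 \<le> c + real m" if x: "x \<in> ?Y" and c: "reach ?W q x c" for x c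
    proof -
      have qV: "q \<in> V'" "q \<notin> V" using True S SV by auto
      obtain a b where ab: "a + b = c" "reach W (if q \<in> V then q else p) (if x \<in> V then x else p) a"
        "reach W' (if q \<in> V' then q else p) (if x \<in> V' then x else p) b"
        by (rule dec[OF c])
      note nn = reach_nonneg[OF ab(2)] reach_nonneg[OF ab(3)]
      note ab = ab[unfolded if_P[OF qV(1)] if_not_P[OF qV(2)]]
      show ?thesis
      proof (cases "x \<in> X")
        case x: True
        then have "x \<in> V" "x \<in> V' \<Longrightarrow> x = p" using X(1) common by auto
        then have "reach W p x a" "reach W' q p b" using ab by (auto split: if_splits)
        then have "D + 1 \<le> a + real (Suc m)" "1 \<le> b"
          using X(3)[OF x] sp True unfolding splitter_def by blast+
        then show ?thesis using ab(1) by simp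
      next
        case False
        then have "x = z q" "x \<in> V'" using x zS True by auto
        then have "D - real m + 1 \<le> b"
          using ab(3) sp True unfolding splitter_def by auto
        then show ?thesis using ab(1) nn by simp
      qed
    qed
    have near: "\<exists>x\<in>?Y. \<exists>c. reach ?W q' x c \<and> c + real (?h q') \<le> D"
      if q': "q' \<in> P - {p} \<union> S" "q' \<noteq> q" for q'
    proof (cases "q' \<in> S")
      case False
      then show ?thesis using X(4)[of q'] q' l by fastforce
    next
      case q'S: True
      then obtain c where "c \<le> D - real m" "reach W' q' (z q) c"
        using sp True q'(2) unfolding splitter_def by blast
      then show ?thesis using r q'S by (intro bexI[of _ "z q"] exI[of _ c]) auto
    qed
    have "card ?Y \<le> Suc (card X)" using finX by (simp add: card_insert_if)
    then have "card ?Y + m \<le> k" using X(2) by simp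
    then show ?thesis using far near X(1) zS True by (intro exI[of _ ?Y]) auto
  qed
qed

text \<open>Q is an invariant kept by gluing: a ranking that shows acyclicity, or a drawing.
  Replacing a point with h = m + 1 by B points with h = m preserves the sum of B ^ h, which
  therefore is the final number of points, and lowers the sum of h * B ^ h, the measure of the
  induction.\<close>

lemma split_all_points:
  fixes Q :: "'a set \<Rightarrow> ('a \<Rightarrow> 'a \<Rightarrow> real) \<Rightarrow> bool"
  assumes split: "\<And>V W p m. net V W \<Longrightarrow> Q V W \<Longrightarrow> p \<in> V \<Longrightarrow> m < M \<Longrightarrow>
      \<exists>V' W' S z. splitter V' W' p S z (D - real m) \<and> card S = B \<and> V \<inter> V' = {p} \<and>
        Q (V \<union> V') (glue W W')"
    and "0 < B"
  shows "net V W \<Longrightarrow> Q V W \<Longrightarrow> hard_points V W P h k D \<Longrightarrow> (\<And>p. p \<in> P \<Longrightarrow> h p \<le> M) \<Longrightarrow>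
    \<exists>V W P'. net V W \<and> Q V W \<and> hard_points V W P' (\<lambda>_. 0) k D \<and> card P' = (\<Sum>p\<in>P. B ^ h p)"
proof (induction "\<Sum>p\<in>P. h p * B ^ h p" arbitrary: V W P h rule: less_induct)
  case less
  have PV: "P \<subseteq> V" and "finite V" using less.prems(3) netD(1)[OF less.prems(1)]
    unfolding hard_points_def by blast+
  then have finP: "finite P" using finite_subset by blast
  show ?case
  proof (cases "\<forall>p\<in>P. h p = 0")
    case True
    then have "hard_points V W P (\<lambda>_. 0) k D"
      using less.prems(3) unfolding hard_points_def by simp
    then show ?thesis using less.prems(1,2) True by (intro exI[of _ V] exI[of _ W] exI[of _ P]) simp
  next
    case False
    then obtain p m where p: "p \<in> P" "h p = Suc m" by (metis not0_implies_Suc)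
    then have "m < M" using less.prems(4)[of p] by simp
    then obtain V' W' S z where s: "splitter V' W' p S z (D - real m)" "card S = B"
      "V \<inter> V' = {p}" "Q (V \<union> V') (glue W W')"
      using split[OF less.prems(1,2), of p m] p(1) PV by blast
    let ?h = "\<lambda>q. if q \<in> S then m else h q" and ?P = "P - {p} \<union> S"
    have disj: "(P - {p}) \<inter> S = {}"
      using s(1,3) PV unfolding splitter_def by blast
    have finS: "finite S" using s(2) \<open>0 < B\<close> card.infinite by fastforce
    have eq: "(\<Sum>q\<in>?P. f (?h q)) = (\<Sum>q\<in>P - {p}. f (h q)) + B * f m" for f :: "nat \<Rightarrow> nat"
    proof -
      have "(\<Sum>q\<in>?P. f (?h q)) = (\<Sum>q\<in>P - {p}. f (?h q)) + (\<Sum>q\<in>S. f (?h q))"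
        using disj finP finS by (simp add: sum.union_disjoint)
      also have "(\<Sum>q\<in>P - {p}. f (?h q)) = (\<Sum>q\<in>P - {p}. f (h q))"
        using disj by (intro sum.cong) auto
      finally show ?thesis using s(2) by simp
    qed
    have eq': "(\<Sum>q\<in>P. f (h q)) = (\<Sum>q\<in>P - {p}. f (h q)) + f (Suc m)" for f :: "nat \<Rightarrow> nat"
      using sum.remove[OF finP p(1), of "\<lambda>q. f (h q)"] p(2) by simp
    have dec: "(\<Sum>q\<in>?P. ?h q * B ^ ?h q) < (\<Sum>q\<in>P. h q * B ^ h q)"
      using eq[of "\<lambda>i. i * B ^ i"] eq'[of "\<lambda>i. i * B ^ i"] \<open>0 < B\<close> by simp
    have sums: "(\<Sum>q\<in>?P. B ^ ?h q) = (\<Sum>q\<in>P. B ^ h q)"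
      using eq[of "\<lambda>i. B ^ i"] eq'[of "\<lambda>i. B ^ i"] by simp
    have net': "net V' W'" using s(1) unfolding splitter_def by blast
    have hp: "hard_points (V \<union> V') (glue W W') ?P ?h k D"
      by (rule hard_points_glue_splitter[OF less.prems(1,3) p s(1,3)])
    have "?h q \<le> M" if "q \<in> ?P" for q
      using that less.prems(4) \<open>m < M\<close> by auto
    from less.hyps[OF dec net_glue[OF less.prems(1) net' s(3)] s(4) hp this]
    show ?thesis unfolding sums .
  qed
qed

section \<open>Copies of a net on fresh vertices\<close>

definition relabel :: "'b set \<Rightarrow> ('b \<Rightarrow> 'a) \<Rightarrow> ('b \<Rightarrow> 'b \<Rightarrow> real) \<Rightarrow> 'a \<Rightarrow> 'a \<Rightarrow> real" where
  "relabel V f W u v =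
     (if u \<in> f ` V \<and> v \<in> f ` V then W (inv_into V f u) (inv_into V f v) else 0)"

context
  fixes V :: "'b set" and f :: "'b \<Rightarrow> 'a" and W :: "'b \<Rightarrow> 'b \<Rightarrow> real"
  assumes net: "net V W" and inj: "inj_on f V"
begin

lemma relabel_eq: "u \<in> V \<Longrightarrow> v \<in> V \<Longrightarrow> relabel V f W (f u) (f v) = W u v"
  unfolding relabel_def using inj by (simp add: inv_into_f_f)

lemma relabel_posD:
  assumes "relabel V f W u v > 0"
  obtains x y where "x \<in> V" "y \<in> V" "u = f x" "v = f y" "W x y > 0"
  using assms inj unfolding relabel_def by (auto split: if_splits simp: inv_into_f_f)

lemma reach_relabel_aux:
  assumes "reach W u v c" "v \<in> V"
  shows "reach (relabel V f W) (f u) (f v) c"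
  using assms
proof (induction rule: reach.induct)
  case (reach_step u x v c)
  then show ?case
    using reach.reach_step[of "relabel V f W" "f u" "f x" "f v" c]
      relabel_eq[OF netD(5,6)[OF net reach_step(1)]] by simp
qed (rule reach_refl)

lemma reach_relabel:
  assumes "u \<in> V" "v \<in> V"
  shows "reach (relabel V f W) (f u) (f v) c \<longleftrightarrow> reach W u v c"
proof
  have "reach (relabel V f W) x y c \<Longrightarrow> x = f u \<Longrightarrow> u \<in> V \<Longrightarrow> y = f v \<Longrightarrow> reach W u v c" for x y u
  proof (induction arbitrary: u rule: reach.induct)
    case (reach_refl x)
    then have "u = v" using inj_onD[OF inj] assms(2) by metis
    then show ?case by (simp add: reach.reach_refl)
  next
    case (reach_step x x' y c)
    obtain a b where ab: "a \<in> V" "b \<in> V" "x = f a" "x' = f b" "W a b > 0"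
      by (rule relabel_posD[OF reach_step(1)])
    then have "a = u" using reach_step.prems inj_onD[OF inj] by metis
    moreover have "reach W b v c" using reach_step.IH reach_step.prems ab by blast
    ultimately show ?case using reach.reach_step[of W a b v c] ab relabel_eq by simp
  qed
  then show "reach (relabel V f W) (f u) (f v) c \<Longrightarrow> reach W u v c" using assms by blast
qed (rule reach_relabel_aux[OF _ assms(2)])

lemma net_relabel: "net (f ` V) (relabel V f W)"
  unfolding net_def
proof (intro conjI allI impI ballI)
  fix u v
  show "relabel V f W u v = relabel V f W v u" "0 \<le> relabel V f W u v"
    unfolding relabel_def using netD(3,4)[OF net] by (simp_all)
  show "u \<in> f ` V" "v \<in> f ` V" "u \<noteq> v" if "relabel V f W u v \<noteq> 0"
    using that netD(7)[OF net] unfolding relabel_def by (auto split: if_splits)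
next
  fix u v assume "u \<in> f ` V" "v \<in> f ` V"
  then show "\<exists>c. reach (relabel V f W) u v c"
    using netD(10)[OF net] reach_relabel by blast
qed (use netD(1,2)[OF net] in auto)

lemma splitter_relabel:
  assumes "splitter V W r S z a"
  shows "splitter (f ` V) (relabel V f W) (f r) (f ` S) (\<lambda>u. f (z (inv_into V f u))) a"
proof -
  have S: "S \<subseteq> V" "r \<in> V" "r \<notin> S" "\<And>s. s \<in> S \<Longrightarrow> z s \<in> V" using assms unfolding splitter_def by blast+
  have [simp]: "inv_into V f (f s) = s" if "s \<in> V" for s using inj that by simp
  show ?thesis
    unfolding splitter_def
  proof (intro conjI ballI)
    show "net (f ` V) (relabel V f W)" by (rule net_relabel)
    show "f r \<in> f ` V" using S by blast
    show "f ` S \<subseteq> f ` V - {f r}" using S inj_onD[OF inj] by blast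
    show "(\<lambda>u. f (z (inv_into V f u))) ` f ` S \<subseteq> f ` V" using S by auto
    fix s assume "s \<in> f ` S"
    then obtain t where t: "t \<in> S" "s = f t" "t \<in> V" using S by blast
    note R = reach_relabel[OF t(3) S(2)] reach_relabel[OF t(3) S(4)[OF t(1)]]
    show "\<exists>c\<le>1. reach (relabel V f W) s (f r) c" "\<forall>c. reach (relabel V f W) s (f r) c \<longrightarrow> 1 \<le> c"
      using assms t R(1) unfolding splitter_def by auto
    show "\<forall>c. reach (relabel V f W) s (f (z (inv_into V f s))) c \<longrightarrow> a + 1 \<le> c"
      using assms t R(2) unfolding splitter_def by auto
    fix s' assume "s' \<in> f ` S - {s}"
    then obtain t' where t': "t' \<in> S - {t}" "s' = f t'" "t' \<in> V" using S t by blast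
    then obtain c where "c \<le> a" "reach W t' (z t) c" using assms t(1) unfolding splitter_def by blast
    then show "\<exists>c\<le>a. reach (relabel V f W) s' (f (z (inv_into V f s))) c"
      using reach_relabel[OF t'(3) S(4)[OF t(1)]] t t' by auto
  qed
qed

end

text \<open>Labels above the maximum of V are new; only the root r is sent into V.\<close>

lemma ex_fresh_labels:
  fixes V :: "nat set" and V' :: "nat set"
  assumes "finite V" "p \<in> V" "r \<in> V'"
  shows "\<exists>f. inj_on f V' \<and> f r = p \<and> V \<inter> f ` V' = {p}"
proof -
  let ?f = "\<lambda>a. if a = r then p else Suc (Max V) + a"
  have M: "x \<le> Max V" if "x \<in> V" for x using that assms(1) by simp
  have "inj_on ?f V'" using M[OF assms(2)] by (auto simp: inj_on_def)
  moreover have "V \<inter> ?f ` V' = {p}" using M assms(2,3) by fastforce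
  ultimately show ?thesis by (intro exI[of _ ?f]) simp
qed

section \<open>Edge lists and trees\<close>

primrec edge_weight :: "('a \<times> 'a \<times> real) list \<Rightarrow> 'a \<Rightarrow> 'a \<Rightarrow> real" where
  "edge_weight [] u v = 0"
| "edge_weight (e # E) u v =
     (case e of (a, b, w) \<Rightarrow> if u = a \<and> v = b \<or> u = b \<and> v = a then w else edge_weight E u v)"

lemma edge_weight_sym: "edge_weight E u v = edge_weight E v u"
  by (induction E) auto

lemma edge_weight_nonzeroD:
  "edge_weight E u v \<noteq> 0 \<Longrightarrow>
    (u, v, edge_weight E u v) \<in> set E \<or> (v, u, edge_weight E u v) \<in> set E"
  by (induction E) (auto split: if_splits)

text \<open>Every vertex other than 0 is the larger end of some edge, so moving to smaller ends
  leads to 0: connectedness becomes a local check. The order a < b and the distinctness of the end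
  pairs make \<open>edge_weight\<close>, which returns the first match, agree with every
  entry.\<close>

definition edge_list :: "nat \<Rightarrow> (nat \<times> nat \<times> real) list \<Rightarrow> bool" where
  "edge_list n E \<longleftrightarrow> 0 < n \<and> (\<forall>(a, b, w)\<in>set E. a < b \<and> b < n \<and> 0 < w) \<and>
     distinct (map (\<lambda>(a, b, w). (a, b)) E) \<and> (\<forall>v<n. v = 0 \<or> v \<in> (\<lambda>(a, b, w). b) ` set E)"

context
  fixes n :: nat and E
  assumes E: "edge_list n E"
begin

lemma edge_weight_eq:
  assumes "(a, b, w) \<in> set E"
  shows "edge_weight E a b = w" "edge_weight E b a = w"
proof -
  have *: "a < b \<and> b < n \<and> 0 < w" if "(a, b, w) \<in> set E" for a b w
    using E that unfolding edge_list_def by blast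
  have "edge_weight E' a b = w"
    if "(a, b, w) \<in> set E'" "set E' \<subseteq> set E" "distinct (map (\<lambda>(a, b, w). (a, b)) E')" for E'
    using that
  proof (induction E')
    case (Cons e E')
    obtain a' b' w' where e: "e = (a', b', w')" by (cases e) auto
    have "(a', b', w') \<in> set E" "(a, b, w) \<in> set E" using Cons.prems(1,2) e by auto
    from this[THEN *] have "a' < b'" "a < b" by blast+
    show ?case
    proof (cases "(a, b, w) = e")
      case True
      then show ?thesis by auto
    next
      case False
      then have w: "(a, b, w) \<in> set E'" using Cons.prems(1) by simp
      then have "(a, b) \<in> set (map (\<lambda>(a, b, w). (a, b)) E')" by force
      then have "(a, b) \<noteq> (a', b')" using Cons.prems(3) unfolding e by (auto simp del: set_map)
      moreover have "(a, b) \<noteq> (b', a')" using \<open>a' < b'\<close> \<open>a < b\<close> by auto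
      ultimately show ?thesis using Cons.IH[OF w] Cons.prems e by auto
    qed
  qed simp
  then show "edge_weight E a b = w" using assms E unfolding edge_list_def by blast
  then show "edge_weight E b a = w" using edge_weight_sym by metis
qed

lemma net_edge_weight: "net {..<n} (edge_weight E)"
proof -
  have *: "a < b \<and> b < n \<and> 0 < w" if "(a, b, w) \<in> set E" for a b w
    using E that unfolding edge_list_def by blast
  show ?thesis
    unfolding net_def
  proof (intro conjI allI impI ballI)
    show "{..<n} \<noteq> {}" using E unfolding edge_list_def by blast
    fix u v
    show "edge_weight E u v = edge_weight E v u" by (rule edge_weight_sym)
    show "0 \<le> edge_weight E u v"
      using edge_weight_nonzeroD[of E u v] * by (metis less_eq_real_def)
    show "u \<in> {..<n}" "v \<in> {..<n}" "u \<noteq> v" if "edge_weight E u v \<noteq> 0"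
      using edge_weight_nonzeroD[OF that] *[of u v] *[of v u] by fastforce+
  next
    have 0: "\<exists>c. reach (edge_weight E) u 0 c" if "u < n" for u
      using that
    proof (induction u rule: less_induct)
      case (less u)
      show ?case
      proof (cases "u = 0")
        case False
        then have "u \<in> (\<lambda>(a, b, w). b) ` set E" using E less.prems unfolding edge_list_def by blast
        then obtain a w where e: "(a, u, w) \<in> set E" by auto
        have a: "a < u" "0 < w" "a < n" using *[OF e] less.prems by linarith+
        then obtain c where "reach (edge_weight E) a 0 c" using less.IH by blast
        then show ?thesis
          using reach_step[of "edge_weight E" u a 0 c] a edge_weight_eq(2)[OF e] by auto
      qed (auto intro: reach_refl)
    qed
    fix u v assume "u \<in> {..<n}" "v \<in> {..<n}"
    then show "\<exists>c. reach (edge_weight E) u v c"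
      using 0[of u] 0[of v] reach_sym[of "edge_weight E", OF edge_weight_sym] reach_trans
      by (metis lessThan_iff)
  qed simp
qed

end

lemma reach_edge_list_potential:
  assumes "\<And>a b w. (a, b, w) \<in> set E \<Longrightarrow> \<phi> a \<le> \<phi> b + w \<and> \<phi> b \<le> \<phi> a + w"
    and "reach (edge_weight E) u v c"
  shows "\<phi> u - \<phi> v \<le> (c :: real)"
proof -
  have "- \<phi> v - - \<phi> u \<le> c"
  proof (rule reach_potential[OF _ assms(2)])
    fix u v assume "edge_weight E u v > 0"
    then have "edge_weight E u v \<noteq> 0" by simp
    from edge_weight_nonzeroD[OF this] show "- \<phi> v \<le> - \<phi> u + edge_weight E u v"
      using assms(1) by fastforce
  qed
  then show ?thesis by simp
qed

text \<open>A certificate of acyclicity: with h as a depth, the only neighbour of a vertex that is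
  not strictly deeper is its parent.\<close>

definition parented :: "('a \<Rightarrow> 'a \<Rightarrow> real) \<Rightarrow> ('a \<Rightarrow> nat) \<Rightarrow> bool" where
  "parented W h \<longleftrightarrow>
     (\<forall>v u u'. W v u > 0 \<and> W v u' > 0 \<and> h u \<le> h v \<and> h u' \<le> h v \<longrightarrow> u = u')"

lemma pcas_nth: "pcas u p v \<Longrightarrow> Suc i < length p \<Longrightarrow> fst (p ! Suc i) = snd (p ! i)"
proof (induction p arbitrary: u i)
  case (Cons e p)
  then show ?case by (cases i; cases p) auto
qed simp

lemma pcas_ends: "pcas u p v \<Longrightarrow> p \<noteq> [] \<Longrightarrow> fst (hd p) = u \<and> snd (last p) = v"
  by (induction p arbitrary: u) auto

text \<open>At a vertex of maximal rank, both neighbours on a cycle would be the parent.\<close>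

lemma tree_graph_of:
  assumes net: "net V W" and "parented W h"
  shows "tree_graph (graph_of V W)"
proof -
  interpret pair_graph "graph_of V W" by (rule pair_graph_of[OF net])
  have False if "cycle p" "3 \<le> length p" for p
  proof -
    obtain u where u: "awalk u p u" "distinct (tl (pawalk_verts u p))" "p \<noteq> []"
      using \<open>cycle p\<close> unfolding cycle_def by blast
    let ?n = "length p"
    have cas: "pcas u p u" and arcs: "\<And>e. e \<in> set p \<Longrightarrow> W (fst e) (snd e) > 0"
      using u(1) unfolding awalk_def by auto
    have "tl (pawalk_verts u p) = map snd p"
      using awalk_verts_conv'[of u p u] cas u(3) by simp
    then have dist: "distinct (map snd p)" using u(2) by simp
    \<comment> \<open>The cyclic successor of an arc: the last arc ends where the first one
      starts.\<close>
    define nx where "nx i = (if Suc i = ?n then 0 else Suc i)" for i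
    have nx: "nx i < ?n" "fst (p ! nx i) = snd (p ! i)" if "i < ?n" for i
    proof -
      show "nx i < ?n" using that unfolding nx_def by auto
      show "fst (p ! nx i) = snd (p ! i)"
      proof (cases "Suc i = ?n")
        case True
        then have "p ! i = last p" using u(3) by (simp add: last_conv_nth[OF u(3)] flip: True)
        then show ?thesis using True pcas_ends[OF cas u(3)] u(3) unfolding nx_def
          by (simp add: hd_conv_nth)
      next
        case False
        then show ?thesis using that pcas_nth[OF cas, of i] unfolding nx_def by simp
      qed
    qed
    obtain j where j: "j < ?n" "\<And>i. i < ?n \<Longrightarrow> h (snd (p ! i)) \<le> h (snd (p ! j))"
    proof -
      have "\<exists>j. j \<in> {..<?n} \<and> (\<forall>i. i \<in> {..<?n} \<longrightarrow> h (snd (p ! i)) \<le> h (snd (p ! j)))"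
        using ex_has_greatest_nat[of "\<lambda>i. i \<in> {..<?n}" 0 "\<lambda>i. h (snd (p ! i))"
            "Suc (Max ((\<lambda>i. h (snd (p ! i))) ` {..<?n}))"] u(3)
        by (auto simp: less_Suc_eq_le intro!: Max_ge)
      then show thesis using that by blast
    qed
    define i where "i = (if j = 0 then ?n - 1 else j - 1)"
    have i: "i < ?n" "nx i = j" using j(1) \<open>3 \<le> ?n\<close> unfolding i_def nx_def by auto
    \<comment> \<open>Length at least 3 enters here: on a closed walk u, v, u the preceding and the
      following arc coincide.\<close>
    have "i \<noteq> nx j" using j(1) \<open>3 \<le> ?n\<close> unfolding i_def nx_def by auto
    let ?v = "snd (p ! j)"
    have "W ?v (snd (p ! nx j)) > 0" using arcs[of "p ! nx j"] nx[OF j(1)] by simp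
    moreover have "W ?v (snd (p ! i)) > 0"
      using arcs[of "p ! j"] nx[OF i(1)] i j(1) netD(3)[OF net] by (metis nth_mem)
    ultimately have "snd (p ! i) = snd (p ! nx j)"
      using \<open>parented W h\<close> j(2)[OF i(1)] j(2)[OF nx(1)[OF j(1)]] unfolding parented_def by blast
    then show False
      using dist i(1) nx(1)[OF j(1)] \<open>i \<noteq> nx j\<close> by (simp add: distinct_conv_nth)
  qed
  then show ?thesis unfolding tree_graph_def
    using pair_graph_of[OF net] connected_graph_of[OF net] by blast
qed

text \<open>The ranks of the second part are shifted to lie above h p, so that p keeps its parent in
  W and gains only children. Subtraction of naturals does not truncate on V', where h' p is the
  least value.\<close>

lemma parented_glue:
  assumes net: "net V W" and net': "net V' W'" and common: "V \<inter> V' = {p}"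
    and h: "parented W h" and h': "parented W' h'" and root: "\<And>v. v \<in> V' - {p} \<Longrightarrow> h' p < h' v"
  shows "parented (glue W W') (\<lambda>v. if v \<in> V then h v else h p + h' v - h' p)"
    (is "parented _ ?h")
proof -
  have 1: "W v u > 0 \<or> (W' v u > 0 \<and> u \<in> V' - {p} \<and> v = p) \<or> (W' v u > 0 \<and> v \<in> V' - {p})"
    if "glue W W' v u > 0" for v u
    using that glue_pos[OF net net'] netD(5,6)[OF net', of v u] netD(7)[OF net', of p] by auto
  have V: "v \<in> V \<and> u \<in> V" if "W v u > 0" for u v using netD(5,6)[OF net that] by blast
  have V': "v \<in> V' \<and> u \<in> V'" if "W' v u > 0" for u v using netD(5,6)[OF net' that] by blast
  have h_le: "?h u \<le> ?h v \<longleftrightarrow> h' u \<le> h' v" if "u \<in> V'" "v \<in> V' - {p}" for u v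
  proof -
    have v: "v \<notin> V" "h' p < h' v" using that(2) root[OF that(2)] common by blast+
    show ?thesis
    proof (cases "u = p")
      case True
      then have "u \<in> V" using common by blast
      then show ?thesis using v True by simp
    next
      case False
      then have "u \<notin> V" "h' p < h' u" using that(1) root[of u] common by blast+
      then show ?thesis using v by simp linarith
    qed
  qed
  have up: "W v u > 0" if "glue W W' v u > 0" "v \<in> V" "?h u \<le> ?h v" for u v
  proof (rule ccontr)
    assume "\<not> W v u > 0"
    then have u: "u \<in> V' - {p}" "v = p" using 1[OF that(1)] that(2) common by blast+
    then have "u \<notin> V" "h' p < h' u" using root[of u] common by blast+
    then show False using that(2,3) u(2) by simp
  qed
  have up': "W' v u > 0 \<and> h' u \<le> h' v" if "glue W W' v u > 0" "v \<notin> V" "?h u \<le> ?h v" for u v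
  proof -
    have w: "W' v u > 0" "v \<in> V' - {p}" using 1[OF that(1)] that(2) V common by blast+
    then show ?thesis using h_le[of u v] V' that(3) by blast
  qed
  show ?thesis
    unfolding parented_def
  proof (intro allI impI)
    fix v u u'
    assume a: "0 < glue W W' v u \<and> 0 < glue W W' v u' \<and> ?h u \<le> ?h v \<and> ?h u' \<le> ?h v"
    show "u = u'"
    proof (cases "v \<in> V")
      case True
      then have "W v u > 0" "W v u' > 0" using a up by blast+
      moreover have "h u \<le> h v" "h u' \<le> h v" using a True V[OF calculation(1)] V[OF calculation(2)] by auto
      ultimately show ?thesis using h unfolding parented_def by blast
    next
      case False
      then show ?thesis using a up' h' unfolding parented_def by blast
    qed
  qed
qed

text \<open>Vertex 0 is the root, 1 and 2 are the ports, and the center of each port hangs at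
  distance a from the other port.\<close>

definition tree_splitter :: "real \<Rightarrow> (nat \<times> nat \<times> real) list" where
  "tree_splitter a = [(0, 1, 1), (0, 2, 1), (2, 3, a), (1, 4, a)]"

lemma all_less_numeral: "(\<forall>v<numeral k :: nat. Q v) \<longleftrightarrow> (\<forall>v<pred_numeral k. Q v) \<and> Q (pred_numeral k)"
  by (auto simp: numeral_eq_Suc less_Suc_eq)

lemma edge_list_tree_splitter: "0 < a \<Longrightarrow> edge_list 5 (tree_splitter a)"
  unfolding edge_list_def tree_splitter_def by (auto simp: all_less_numeral image_iff)

lemma splitter_tree:
  assumes "0 < a"
  shows "splitter {..<5} (edge_weight (tree_splitter a)) 0 {1, 2} (\<lambda>s. if s = 1 then 3 else 4) a"
proof -
  let ?W = "edge_weight (tree_splitter a)"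
  note E = edge_list_tree_splitter[OF assms]
  have up: "reach ?W 1 0 1" "reach ?W 2 0 1" "reach ?W 2 3 a" "reach ?W 1 4 a"
    using reach_edge[of ?W 1 0] reach_edge[of ?W 2 0] reach_edge[of ?W 2 3] reach_edge[of ?W 1 4] assms
    by (simp_all add: tree_splitter_def)
  have low: "\<phi> u - \<phi> v \<le> c" if "reach ?W u v c"
    "\<forall>(a, b, w)\<in>set (tree_splitter a). \<phi> a \<le> \<phi> b + w \<and> \<phi> b \<le> \<phi> a + w" for \<phi> u v c
    using reach_edge_list_potential[OF _ that(1), of \<phi>] that(2) by blast
  have l0: "1 \<le> c" if "reach ?W 1 0 c \<or> reach ?W 2 0 c" for c
    using that low[of 1 0 c "\<lambda>v. if v = 0 then 0 else 1"] low[of 2 0 c "\<lambda>v. if v = 0 then 0 else 1"] assms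
    by (auto simp: tree_splitter_def)
  \<comment> \<open>The true distance is a + 2; a potential that is constant on 0 and 1 already
    gives the required a + 1.\<close>
  have l1: "a + 1 \<le> c" if "reach ?W 1 3 c" for c
    using low[OF that, of "\<lambda>v. if v = 3 then 0 else if v = 2 then a else a + 1"] assms
    by (auto simp: tree_splitter_def)
  have l2: "a + 1 \<le> c" if "reach ?W 2 4 c" for c
    using low[OF that, of "\<lambda>v. if v = 4 then 0 else if v = 1 then a else a + 1"] assms
    by (auto simp: tree_splitter_def)
  have "net {..<5} ?W" by (rule net_edge_weight[OF E])
  then show ?thesis unfolding splitter_def
    using up l0 l1 l2 by (auto intro: order_refl)
qed

section \<open>Straight-line drawings\<close>

definition straight_drawing :: "'a set \<Rightarrow> ('a \<Rightarrow> 'a \<Rightarrow> real) \<Rightarrow> ('a \<Rightarrow> complex) \<Rightarrow> bool" where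
  "straight_drawing V W pos \<longleftrightarrow> inj_on pos V \<and>
     (\<forall>u v x y. W u v > 0 \<and> W x y > 0 \<and> {u, v} \<noteq> {x, y} \<longrightarrow>
        closed_segment (pos u) (pos v) \<inter> closed_segment (pos x) (pos y) \<subseteq> pos ` ({u, v} \<inter> {x, y}))"

text \<open>By connectedness x has an edge of its own, whose segment contains pos x; a vertex inside
  a foreign edge would thus be a forbidden crossing of two edges.\<close>

lemma straight_drawing_vertex_on_edge:
  assumes net: "net V W" and draw: "straight_drawing V W pos"
    and "W u v > 0" "x \<in> V" "pos x \<in> closed_segment (pos u) (pos v)"
  shows "x \<in> {u, v}"
proof (rule ccontr)
  assume x: "x \<notin> {u, v}"
  have uv: "u \<in> V" "v \<in> V" using netD(5,6)[OF net \<open>W u v > 0\<close>] by blast+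
  then obtain c where "reach W x u c" using netD(10)[OF net \<open>x \<in> V\<close>] by blast
  then obtain y where y: "W x y > 0" using x by (cases rule: reach.cases) auto
  have "{u, v} \<noteq> {x, y}" using x by blast
  then have "closed_segment (pos u) (pos v) \<inter> closed_segment (pos x) (pos y) \<subseteq> pos ` ({u, v} \<inter> {x, y})"
    using draw \<open>W u v > 0\<close> y unfolding straight_drawing_def by blast
  then have "pos x \<in> pos ` {u, v}" using assms(5) by auto
  then show False using draw x \<open>x \<in> V\<close> uv unfolding straight_drawing_def inj_on_def by blast
qed

lemma planar_graph_of:
  assumes net: "net V W" and draw: "straight_drawing V W pos"
  shows "planar_graph (graph_of V W)"
proof -
  let ?\<gamma> = "\<lambda>(u, v). linepath (pos u) (pos v)"
  have ne: "pos u \<noteq> pos v" if "W u v > 0" for u v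
  proof -
    have "u \<in> V" "v \<in> V" "u \<noteq> v"
      using netD(5,6)[OF net that] netD(7)[OF net, of u] that by auto
    then show ?thesis using draw unfolding straight_drawing_def inj_on_def by blast
  qed
  have "plane_drawing (graph_of V W) pos ?\<gamma>"
    unfolding plane_drawing_def
  proof (intro conjI allI impI)
    show "inj_on pos (pverts (graph_of V W))"
      using draw unfolding straight_drawing_def by simp
    fix u v assume "(u, v) \<in> parcs (graph_of V W)"
    then have w: "W u v > 0" by simp
    show "Path_Connected.arc (?\<gamma> (u, v))" using ne[OF w] by (simp add: arc_linepath)
    show "pathstart (?\<gamma> (u, v)) = pos u" "pathfinish (?\<gamma> (u, v)) = pos v"
      "?\<gamma> (v, u) = reversepath (?\<gamma> (u, v))" by simp_all
    show "path_image (?\<gamma> (u, v)) \<inter> pos ` pverts (graph_of V W) \<subseteq> {pos u, pos v}"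
      using straight_drawing_vertex_on_edge[OF net draw w] by auto
  next
    fix u v x y
    assume "(u, v) \<in> parcs (graph_of V W) \<and> (x, y) \<in> parcs (graph_of V W) \<and> {u, v} \<noteq> {x, y}"
    then show "path_image (?\<gamma> (u, v)) \<inter> path_image (?\<gamma> (x, y)) \<subseteq> pos ` ({u, v} \<inter> {x, y})"
      using draw unfolding straight_drawing_def by simp
  qed
  then show ?thesis unfolding planar_graph_def using pair_graph_of[OF net] by blast
qed

text \<open>The points c + d * z form a thin cone with apex c and axis d. If c is off the segment, a
  ball around c avoids the segment. If c is the end a, the other end is off the line through c in
  direction d (or equals c), and an opening below its slope suffices.\<close>

lemma ex_empty_cone_segment:
  fixes a b c d :: complex
  assumes "c \<in> closed_segment a b \<Longrightarrow> c = a"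
    and "d \<noteq> 0" and "Im ((b - c) / d) \<noteq> 0 \<or> b = c"
  shows "\<exists>\<eta>>0. \<forall>z. 0 < Re z \<and> Re z \<le> \<eta> \<and> \<bar>Im z\<bar> \<le> \<eta> * Re z \<longrightarrow> c + d * z \<notin> closed_segment a b"
proof (cases "c \<in> closed_segment a b")
  case False
  then obtain e where e: "e > 0" "\<And>x. dist x c < e \<Longrightarrow> x \<notin> closed_segment a b"
    using open_contains_ball[of "- closed_segment a b"] closed_segment[of a b]
    by (force simp: mem_ball dist_commute)
  \<comment> \<open>Since \<eta> \<le> 1, points of the cone have |z| \<le> 2 * \<eta>, so they are
    within 2/3 of the radius e from c.\<close>
  define \<eta> where "\<eta> = min 1 (e / (3 * cmod d))"
  have "\<eta> > 0" unfolding \<eta>_def using e \<open>d \<noteq> 0\<close> by simp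
  moreover have "c + d * z \<notin> closed_segment a b"
    if z: "0 < Re z" "Re z \<le> \<eta>" "\<bar>Im z\<bar> \<le> \<eta> * Re z" for z
  proof (rule e(2))
    have "\<eta> * Re z \<le> 1 * Re z" using z(1) unfolding \<eta>_def by (intro mult_right_mono) auto
    then have "cmod z \<le> 2 * \<eta>" using cmod_le[of z] z by linarith
    then have "cmod d * cmod z \<le> cmod d * (2 * (e / (3 * cmod d)))"
      unfolding \<eta>_def by (intro mult_left_mono) auto
    also have "\<dots> < e" using e \<open>d \<noteq> 0\<close> by (simp add: field_simps)
    finally show "dist (c + d * z) c < e" by (simp add: dist_norm norm_mult)
  qed
  ultimately show ?thesis by blast
next
  case True
  then have "c = a" using assms(1) by blast
  define w where "w = (b - c) / d"
  have w: "Im w \<noteq> 0 \<or> w = 0" using assms(3) unfolding w_def by auto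
  \<comment> \<open>At most half the slope of w, with + 1 keeping the denominator positive; a point
    t * w of the segment with t > 0 is then too steep for the cone.\<close>
  define \<eta> where "\<eta> = (if w = 0 then 1 else \<bar>Im w\<bar> / (\<bar>Re w\<bar> + 1) / 2)"
  have "\<eta> > 0" using w unfolding \<eta>_def by (auto intro!: divide_pos_pos)
  moreover have "c + d * z \<notin> closed_segment a b"
    if z: "0 < Re z" "Re z \<le> \<eta>" "\<bar>Im z\<bar> \<le> \<eta> * Re z" for z
  proof
    assume "c + d * z \<in> closed_segment a b"
    then obtain t where t: "0 \<le> t" "c + d * z = (1 - t) *\<^sub>R a + t *\<^sub>R b"
      unfolding closed_segment_def by blast
    then have "d * z = t *\<^sub>R (b - c)" using \<open>c = a\<close> by (simp add: algebra_simps)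
    then have "z = t *\<^sub>R w" using \<open>d \<noteq> 0\<close> unfolding w_def
      by (simp add: field_simps scaleR_conv_of_real)
    then have re: "Re z = t * Re w" and im: "\<bar>Im z\<bar> = t * \<bar>Im w\<bar>"
      using t(1) by (simp_all add: abs_mult)
    then have "0 < t" "w \<noteq> 0" using z(1) t(1) by (auto simp: zero_less_mult_iff)
    then have "\<bar>Im w\<bar> \<le> \<eta> * Re w" using z(3) unfolding re im by (simp add: mult.left_commute)
    also have "\<dots> \<le> \<eta> * (\<bar>Re w\<bar> + 1)" using \<open>\<eta> > 0\<close> by simp
    also have "\<dots> = \<bar>Im w\<bar> / 2"
    proof -
      have "x / N / 2 * N = x / 2" if "N > 0" for x N :: real using that by simp
      moreover have "\<bar>Re w\<bar> + 1 > 0" by (simp add: add_nonneg_pos)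
      ultimately show ?thesis unfolding \<eta>_def if_not_P[OF \<open>w \<noteq> 0\<close>] by blast
    qed
    finally show False using w \<open>w \<noteq> 0\<close> by simp
  qed
  ultimately show ?thesis by blast
qed

text \<open>Finitely many points occupy finitely many slopes as seen from c, and d = 1 + i * y takes
  another slope y. A point with the same real part as c causes no trouble: alignment with d would
  make its imaginary part equal as well.\<close>

lemma ex_direction:
  assumes "finite B"
  shows "\<exists>d :: complex. d \<noteq> 0 \<and> (\<forall>b\<in>B. Im ((b - c) / d) \<noteq> 0 \<or> b = c)"
proof -
  have "infinite (UNIV - (\<lambda>b. Im (b - c) / Re (b - c)) ` B :: real set)"
    using assms by (simp add: infinite_UNIV_char_0)
  then obtain y where y: "y \<notin> (\<lambda>b. Im (b - c) / Re (b - c)) ` B"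
    by (metis Diff_iff finite.emptyI ex_in_conv)
  have "b = c" if "b \<in> B" "Im ((b - c) / Complex 1 y) = 0" for b
  proof -
    have eq: "Im (b - c) = Re (b - c) * y"
    proof -
      have "1 + y\<^sup>2 \<noteq> 0" by (metis add_pos_nonneg less_irrefl zero_le_power2 zero_less_one)
      then show ?thesis using that(2) by (simp add: Im_divide)
    qed
    then have "Re (b - c) = 0" using y that(1) by (force simp: field_simps)
    then show "b = c" using eq by (simp add: complex_eq_iff)
  qed
  then show ?thesis by (intro exI[of _ "Complex 1 y"]) (auto simp: complex_eq_iff)
qed

text \<open>One direction serves all segments, and a smaller \<eta> gives a smaller cone, so the
  least of the finitely many openings works.\<close>

lemma ex_empty_cone:
  fixes c :: complex
  assumes "finite S" and end_pt: "\<And>a b. (a, b) \<in> S \<Longrightarrow> c \<in> closed_segment a b \<Longrightarrow> c = a \<or> c = b"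
  shows "\<exists>d \<eta>. d \<noteq> 0 \<and> \<eta> > 0 \<and> (\<forall>(a, b)\<in>S. \<forall>z. 0 < Re z \<and> Re z \<le> \<eta> \<and> \<bar>Im z\<bar> \<le> \<eta> * Re z \<longrightarrow>
    c + d * z \<notin> closed_segment a b)"
proof -
  obtain d where d: "d \<noteq> 0" "\<And>b. b \<in> fst ` S \<union> snd ` S \<Longrightarrow> Im ((b - c) / d) \<noteq> 0 \<or> b = c"
    using ex_direction[of "fst ` S \<union> snd ` S" c] \<open>finite S\<close> by auto
  have "\<exists>\<eta>>0. \<forall>z. 0 < Re z \<and> Re z \<le> \<eta> \<and> \<bar>Im z\<bar> \<le> \<eta> * Re z \<longrightarrow> c + d * z \<notin> closed_segment a b"
    if ab: "(a, b) \<in> S" for a b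
  proof -
    have *: "Im ((a - c) / d) \<noteq> 0 \<or> a = c" "Im ((b - c) / d) \<noteq> 0 \<or> b = c"
      using ab d(2) by force+
    consider "c \<in> closed_segment a b \<Longrightarrow> c = a" | "c \<in> closed_segment b a \<Longrightarrow> c = b"
      using end_pt[OF ab] by (metis closed_segment_commute)
    then show ?thesis
      using ex_empty_cone_segment[of c a b d, OF _ d(1) *(2)]
        ex_empty_cone_segment[of c b a d, OF _ d(1) *(1)]
      by (cases; simp only: closed_segment_commute[of b a])
  qed
  then obtain f where f: "\<And>a b. (a, b) \<in> S \<Longrightarrow> 0 < f a b \<and> (\<forall>z. 0 < Re z \<and> Re z \<le> f a b \<and>
      \<bar>Im z\<bar> \<le> f a b * Re z \<longrightarrow> c + d * z \<notin> closed_segment a b)"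
    by metis
  define \<eta> where "\<eta> = Min (insert 1 ((\<lambda>(a, b). f a b) ` S))"
  have "\<eta> > 0" unfolding \<eta>_def using f \<open>finite S\<close> by auto
  moreover have "\<eta> \<le> f a b" if "(a, b) \<in> S" for a b
    unfolding \<eta>_def using that \<open>finite S\<close> by (intro Min_le) force+
  then have "c + d * z \<notin> closed_segment a b"
    if "(a, b) \<in> S" "0 < Re z" "Re z \<le> \<eta>" "\<bar>Im z\<bar> \<le> \<eta> * Re z" for a b z
    using that f[OF that(1)] by (meson mult_right_mono order_trans less_imp_le)
  ultimately show ?thesis using d(1) by (intro exI[of _ d] exI[of _ \<eta>]) blast
qed

text \<open>
  The second drawing, with the common vertex leftmost, is flattened and moved into a thin cone at
  that vertex which avoids the first drawing.
\<close>

lemma straight_drawing_glue: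
  assumes net: "net V W" and net': "net V' W'" and common: "V \<inter> V' = {p}"
    and draw: "straight_drawing V W pos" and draw': "straight_drawing V' W' pos'"
    and root: "pos' p = 0" "\<And>v. v \<in> V' - {p} \<Longrightarrow> 0 < Re (pos' v)"
  shows "\<exists>pos. straight_drawing (V \<union> V') (glue W W') pos"
proof -
  have pV: "p \<in> V" "p \<in> V'" using common by auto
  have fin: "finite V" "finite V'" using netD(1)[OF net] netD(1)[OF net'] by blast+
  have eV: "u \<in> V" "v \<in> V" if "W u v > 0" for u v using netD(5,6)[OF net that] by blast+
  have eV': "u \<in> V'" "v \<in> V'" if "W' u v > 0" for u v using netD(5,6)[OF net' that] by blast+
  \<comment> \<open>The degenerate segments make the cone avoid the vertices of the first drawing
    too, which gives injectivity of the combined drawing.\<close>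
  define S where "S = {(pos u, pos v) |u v. W u v > 0} \<union> (\<lambda>v. (pos v, pos v)) ` V"
  have "S \<subseteq> pos ` V \<times> pos ` V" unfolding S_def using eV by auto
  then have "finite S" using fin by (meson finite_SigmaI finite_imageI finite_subset)
  moreover have "pos p = a \<or> pos p = b" if "(a, b) \<in> S" "pos p \<in> closed_segment a b" for a b
    using that straight_drawing_vertex_on_edge[OF net draw _ pV(1)] unfolding S_def by auto
  ultimately obtain d \<eta> where d: "d \<noteq> 0" "\<eta> > 0"
    and cone: "\<And>a b z. (a, b) \<in> S \<Longrightarrow> 0 < Re z \<Longrightarrow> Re z \<le> \<eta> \<Longrightarrow> \<bar>Im z\<bar> \<le> \<eta> * Re z \<Longrightarrow>
      pos p + d * z \<notin> closed_segment a b"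
    using ex_empty_cone[of S "pos p"] by blast
  define R where "R = Max (insert 1 ((\<lambda>v. cmod (pos' v)) ` V'))"
  have R: "R \<ge> 1" "\<And>v. v \<in> V' \<Longrightarrow> cmod (pos' v) \<le> R"
    unfolding R_def using fin by (auto intro: Max_ge)
  define \<rho> where "\<rho> = Min (insert 1 ((\<lambda>v. Re (pos' v)) ` (V' - {p})))"
  have \<rho>: "\<rho> > 0" "\<And>v. v \<in> V' - {p} \<Longrightarrow> \<rho> \<le> Re (pos' v)"
    unfolding \<rho>_def using fin root(2) by auto
  \<comment> \<open>The factor s brings the width of the second drawing down to \<eta>, and \<mu>
    flattens it further: a vertex other than p has Re \<ge> \<rho> and |Im| \<le> R, so \<mu> * R =
    \<eta> * \<rho> bounds its slope by \<eta>.\<close>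
  define s where "s = \<eta> / R"
  define \<mu> where "\<mu> = \<eta> * \<rho> / R"
  have s: "s > 0" "s * R = \<eta>" and \<mu>: "\<mu> > 0" "\<mu> * R = \<eta> * \<rho>"
    unfolding s_def \<mu>_def using d(2) R(1) \<rho>(1) by auto
  define sq where "sq z = Complex (s * Re z) (s * \<mu> * Im z)" for z
  define F where "F z = pos p + d * sq z" for z
  have lin: "linear sq" unfolding sq_def by (intro linearI) (simp_all add: complex_eq_iff algebra_simps)
  have inj: "inj F"
  proof (rule injI)
    fix x y assume "F x = F y"
    then have "sq x = sq y" using d(1) unfolding F_def by simp
    then show "x = y" using s(1) \<mu>(1) unfolding sq_def by (simp add: complex_eq_iff)
  qed
  have F0: "F 0 = pos p" unfolding F_def sq_def by (simp add: complex_eq_iff)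
  have Fseg: "closed_segment (F a) (F b) = F ` closed_segment a b" for a b
  proof -
    have "linear (\<lambda>z. d * sq z)"
      using linear_compose[OF lin linear_times[of d]] by (simp add: o_def)
    from closed_segment_linear_image[OF this] show ?thesis
      unfolding F_def closed_segment_translation by (simp add: image_image)
  qed
  \<comment> \<open>The cone with its apex 0, the image of p. Being convex, it contains the
    flattened edges once it contains the flattened vertices.\<close>
  define C where "C = {z. 0 \<le> Re z \<and> Re z \<le> \<eta> \<and> \<bar>Im z\<bar> \<le> \<eta> * Re z}"
  have "convex C"
  proof -
    have "C = {z. 0 \<le> Re z} \<inter> {z. Re z \<le> \<eta>} \<inter> {z. Im z - \<eta> * Re z \<le> 0} \<inter> {z. - Im z - \<eta> * Re z \<le> 0}"
      unfolding C_def by auto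
    moreover have "convex {z. 0 \<le> Re z}" "convex {z. Re z \<le> \<eta>}"
      by (simp_all add: convex_halfspace_Re_ge convex_halfspace_Re_le)
    moreover have "convex {z. Im z - \<eta> * Re z \<le> 0}" "convex {z. - Im z - \<eta> * Re z \<le> 0}"
    proof -
      have "{z. Im z - \<eta> * Re z \<le> 0} = {z. Complex (- \<eta>) 1 \<bullet> z \<le> 0}"
        "{z. - Im z - \<eta> * Re z \<le> 0} = {z. Complex (- \<eta>) (- 1) \<bullet> z \<le> 0}"
        by (simp_all add: inner_complex_def algebra_simps)
      then show "convex {z. Im z - \<eta> * Re z \<le> 0}" "convex {z. - Im z - \<eta> * Re z \<le> 0}"
        by (simp_all add: convex_halfspace_le)
    qed
    ultimately show ?thesis by (simp add: convex_Int)
  qed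
  have sqC: "sq (pos' v) \<in> C" if "v \<in> V'" for v
  proof (cases "v = p")
    case True
    then show ?thesis using root(1) d(2) unfolding sq_def C_def by simp
  next
    case False
    then have v: "0 < Re (pos' v)" "\<rho> \<le> Re (pos' v)" "Re (pos' v) \<le> R" "\<bar>Im (pos' v)\<bar> \<le> R"
      using root(2) \<rho>(2) R(2)[OF that] abs_Re_le_cmod[of "pos' v"] abs_Im_le_cmod[of "pos' v"] that
      by force+
    have "s * Re (pos' v) \<le> \<eta>" using v(3) s by (metis mult_left_mono less_imp_le)
    moreover have "\<mu> * \<bar>Im (pos' v)\<bar> \<le> \<mu> * R"
      using v(4) \<mu>(1) by (intro mult_left_mono) auto
    moreover have "\<eta> * \<rho> \<le> \<eta> * Re (pos' v)"
      using v(2) d(2) by (intro mult_left_mono) auto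
    ultimately show ?thesis
      using v(1) s(1) \<mu> unfolding sq_def C_def
      by (simp add: abs_mult mult.assoc mult.left_commute[of \<eta> s])
  qed
  have FC: "\<exists>z\<in>C. q = pos p + d * z"
    if q: "q \<in> closed_segment (F (pos' x)) (F (pos' y))" and xy: "x \<in> V'" "y \<in> V'" for q x y
  proof -
    obtain w where w: "w \<in> closed_segment (pos' x) (pos' y)" "q = F w"
      using q unfolding Fseg by blast
    then have "sq w \<in> closed_segment (sq (pos' x)) (sq (pos' y))"
      unfolding closed_segment_linear_image[OF lin] by blast
    then have "sq w \<in> C"
      using closed_segment_subset[OF sqC[OF xy(1)] sqC[OF xy(2)] \<open>convex C\<close>] by blast
    then show ?thesis using w(2) unfolding F_def by blast
  qed
  have C0: "z = 0 \<or> 0 < Re z" if "z \<in> C" for z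
    using that unfolding C_def by (auto simp: complex_eq_iff)
  have hit: "q = pos p"
    if q: "q \<in> closed_segment (F (pos' x)) (F (pos' y))" and xy: "x \<in> V'" "y \<in> V'"
      and ab: "(a, b) \<in> S" "q \<in> closed_segment a b" for q x y a b
  proof -
    obtain z where z: "z \<in> C" "q = pos p + d * z" using FC[OF q xy] by blast
    have "z = 0" using C0[OF z(1)] cone[OF ab(1), of z] z ab(2) unfolding C_def by auto
    then show ?thesis using z(2) by simp
  qed
  define P where "P v = (if v \<in> V then pos v else F (pos' v))" for v
  have PV: "P v = pos v" if "v \<in> V" for v using that unfolding P_def by simp
  have PV': "P v = F (pos' v)" if "v \<in> V'" for v
  proof (cases "v = p")
    case True
    then show ?thesis using pV root(1) F0 unfolding P_def by simp
  next
    case False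
    then show ?thesis using that common unfolding P_def by auto
  qed
  have "inj_on P (V \<union> V')"
  proof -
    have "inj_on P V" using draw PV unfolding straight_drawing_def by (simp add: inj_on_def)
    moreover have "inj_on P V'"
      using draw' PV' inj unfolding straight_drawing_def by (simp add: inj_on_def inj_def)
    moreover have "P v \<noteq> P x" if "v \<in> V - {p}" "x \<in> V'" for v x
    proof
      assume "P v = P x"
      then have "pos v = F (pos' x)" using that PV PV' by simp
      moreover have "(pos v, pos v) \<in> S" using that unfolding S_def by blast
      ultimately have "pos v = pos p"
        using hit[of "pos v" x x "pos v" "pos v"] that by simp
      then show False using that pV(1) draw unfolding straight_drawing_def inj_on_def by blast
    qed
    ultimately show ?thesis using common by (simp add: inj_on_Un) blast
  qed
  moreover
  have mixed: "closed_segment (P u) (P v) \<inter> closed_segment (P x) (P y) \<subseteq> P ` ({u, v} \<inter> {x, y})"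
    if w: "W u v > 0" "W' x y > 0" for u v x y
  proof
    fix q assume q: "q \<in> closed_segment (P u) (P v) \<inter> closed_segment (P x) (P y)"
    have q1: "q \<in> closed_segment (pos u) (pos v)" using q PV eV[OF w(1)] by simp
    have q2: "q \<in> closed_segment (F (pos' x)) (F (pos' y))" using q PV' eV'[OF w(2)] by simp
    have "(pos u, pos v) \<in> S" using w(1) unfolding S_def by blast
    then have qp: "q = pos p" using hit[OF q2 eV'[OF w(2)] _ q1] by blast
    then have "p \<in> {u, v}" using straight_drawing_vertex_on_edge[OF net draw w(1) pV(1)] q1 by blast
    \<comment> \<open>F is injective and sends 0 to the apex, so the edge passes through pos' p
      already in the second drawing.\<close>
    moreover have "p \<in> {x, y}"
    proof -
      obtain z where "z \<in> closed_segment (pos' x) (pos' y)" "F z = F 0"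
        using q2 qp F0 unfolding Fseg by auto
      then have "pos' p \<in> closed_segment (pos' x) (pos' y)" using inj root(1) by (auto dest: injD)
      then show ?thesis using straight_drawing_vertex_on_edge[OF net' draw' w(2) pV(2)] by blast
    qed
    ultimately show "q \<in> P ` ({u, v} \<inter> {x, y})" using qp PV[OF pV(1)] by force
  qed
  have "closed_segment (P u) (P v) \<inter> closed_segment (P x) (P y) \<subseteq> P ` ({u, v} \<inter> {x, y})"
    if g: "glue W W' u v > 0" "glue W W' x y > 0" "{u, v} \<noteq> {x, y}" for u v x y
  proof -
    have "W u v > 0 \<or> W' u v > 0" "W x y > 0 \<or> W' x y > 0"
      using g glue_pos[OF net net'] by blast+
    then consider "W u v > 0" "W x y > 0" | "W' u v > 0" "W' x y > 0"
      | "W u v > 0" "W' x y > 0" | "W x y > 0" "W' u v > 0" by blast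
    then show ?thesis
    proof cases
      case 1
      then have "closed_segment (pos u) (pos v) \<inter> closed_segment (pos x) (pos y) \<subseteq> pos ` ({u, v} \<inter> {x, y})"
        using draw g(3) unfolding straight_drawing_def by blast
      moreover have "P ` ({u, v} \<inter> {x, y}) = pos ` ({u, v} \<inter> {x, y})"
        using eV[OF 1(1)] PV by (intro image_cong) auto
      ultimately show ?thesis using PV eV[OF 1(1)] eV[OF 1(2)] by simp
    next
      case 2
      then have "closed_segment (pos' u) (pos' v) \<inter> closed_segment (pos' x) (pos' y) \<subseteq> pos' ` ({u, v} \<inter> {x, y})"
        using draw' g(3) unfolding straight_drawing_def by blast
      moreover have "P ` ({u, v} \<inter> {x, y}) = F ` pos' ` ({u, v} \<inter> {x, y})"
        using eV'[OF 2(1)] PV' unfolding image_image by (intro image_cong) auto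
      moreover have "closed_segment (P u) (P v) \<inter> closed_segment (P x) (P y) =
        F ` (closed_segment (pos' u) (pos' v) \<inter> closed_segment (pos' x) (pos' y))"
        unfolding PV'[OF eV'(1)[OF 2(1)]] PV'[OF eV'(2)[OF 2(1)]] PV'[OF eV'(1)[OF 2(2)]]
          PV'[OF eV'(2)[OF 2(2)]] Fseg image_Int[OF inj] ..
      ultimately show ?thesis by (simp only: image_mono)
    next
      case 3
      then show ?thesis by (rule mixed)
    next
      case 4
      then show ?thesis using mixed[OF 4] by (simp only: Int_commute)
    qed
  qed
  ultimately show ?thesis unfolding straight_drawing_def by blast
qed

section \<open>Certified distance tables\<close>

lemma reach_scale:
  assumes "0 < (s :: real)"
  shows "reach (\<lambda>u v. s * W u v) u v (s * c) \<longleftrightarrow> reach W u v c"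
proof
  show "reach (\<lambda>u v. s * W u v) u v (s * c)" if "reach W u v c"
    using that
  proof (induction rule: reach.induct)
    case (reach_refl u)
    then show ?case by (simp add: reach.reach_refl)
  next
    case (reach_step u x v c)
    then show ?case
      using reach.reach_step[of "\<lambda>u v. s * W u v" u x v "s * c"] assms by (simp add: distrib_left)
  qed
  have "reach W u v (c / s)" if "reach (\<lambda>u v. s * W u v) u v c" for c
    using that
  proof (induction rule: reach.induct)
    case (reach_refl u)
    then show ?case by (simp add: reach.reach_refl)
  next
    case (reach_step u x v c)
    then show ?case
      using reach.reach_step[of W u x v "c / s"] assms by (simp add: add_divide_distrib zero_less_mult_iff)
  qed
  from this[of "s * c"] show "reach W u v c" if "reach (\<lambda>u v. s * W u v) u v (s * c)"
    using that assms by simp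
qed

lemma net_scale:
  assumes net: "net V W" and "0 < (s :: real)"
  shows "net V (\<lambda>u v. s * W u v)"
  unfolding net_def
proof (intro conjI allI ballI impI)
  fix u v
  show "s * W u v = s * W v u" "0 \<le> s * W u v" using netD(3,4)[OF net, of u v] assms(2) by simp_all
  show "u \<in> V" "v \<in> V" "u \<noteq> v" if "s * W u v \<noteq> 0"
  proof -
    have w: "W u v > 0" using that netD(4)[OF net, of u v] by (simp add: less_le)
    show "u \<in> V" "v \<in> V" using netD(5,6)[OF net w] by blast+
    show "u \<noteq> v" using w netD(7)[OF net, of u] by auto
  qed
next
  fix u v assume "u \<in> V" "v \<in> V"
  then show "\<exists>c. reach (\<lambda>u v. s * W u v) u v c"
    using netD(10)[OF net] reach_scale[OF assms(2)] by metis
qed (use netD(1,2)[OF net] in simp_all)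

lemma straight_drawing_scale:
  "straight_drawing V W pos \<Longrightarrow> 0 < (s :: real) \<Longrightarrow> straight_drawing V (\<lambda>u v. s * W u v) pos"
  unfolding straight_drawing_def by (simp add: zero_less_mult_iff)

section \<open>Integer tests for crossing segments\<close>

type_synonym point = "int \<times> int"

text \<open>The cross product of q - p and r - p; its sign tells on which side of the line through p
  and q the point r lies. Integer coordinates keep the crossing tests executable.\<close>

definition turn :: "point \<Rightarrow> point \<Rightarrow> point \<Rightarrow> int" where
  "turn p q r = (fst q - fst p) * (snd r - snd p) - (snd q - snd p) * (fst r - fst p)"

definition cpoint :: "point \<Rightarrow> complex" where
  "cpoint p = Complex (of_int (fst p)) (of_int (snd p))"

lemma cpoint_eq_iff [simp]: "cpoint p = cpoint q \<longleftrightarrow> p = q"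
  unfolding cpoint_def by (auto simp: prod_eq_iff)

definition same_side :: "point \<Rightarrow> point \<Rightarrow> point \<Rightarrow> point \<Rightarrow> bool" where
  "same_side p q r s \<longleftrightarrow> 0 < turn p q r \<and> 0 < turn p q s \<or> turn p q r < 0 \<and> turn p q s < 0"

text \<open>Sufficient tests only: disjoint bounding boxes, a common end with the fourth point off
  the line, or one segment strictly on one side of the line through the other. Segments that
  continue each other along a line are rejected.\<close>

definition non_crossing :: "point \<times> point \<Rightarrow> point \<times> point \<Rightarrow> bool" where
  "non_crossing e f = (case e of (p, q) \<Rightarrow> case f of (r, s) \<Rightarrow>
     if max (fst p) (fst q) < min (fst r) (fst s) then True
     else if max (fst r) (fst s) < min (fst p) (fst q) then True
     else if max (snd p) (snd q) < min (snd r) (snd s) then True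
     else if max (snd r) (snd s) < min (snd p) (snd q) then True
     else if p = r then turn p q s \<noteq> 0
     else if p = s then turn p q r \<noteq> 0
     else if q = r then turn p q s \<noteq> 0
     else if q = s then turn p q r \<noteq> 0
     else if same_side p q r s then True
     else same_side r s p q)"

definition cseg :: "point \<times> point \<Rightarrow> complex set" where
  "cseg e = closed_segment (cpoint (fst e)) (cpoint (snd e))"

text \<open>The asymmetry between < and \<le> allows the second segment to lie on the separating
  line, which is how the line through an edge is used.\<close>

lemma linear_separation:
  fixes f :: "complex \<Rightarrow> real"
  assumes f: "\<And>x y t. f ((1 - t) *\<^sub>R x + t *\<^sub>R y) = (1 - t) * f x + t * f y"
    and "f a < c" "f b < c" "c \<le> f x" "c \<le> f y"
  shows "closed_segment a b \<inter> closed_segment x y = {}"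
proof -
  have "f z < c" if "z \<in> closed_segment a b" for z
  proof -
    obtain t where "0 \<le> t" "t \<le> 1" "z = (1 - t) *\<^sub>R a + t *\<^sub>R b"
      using \<open>z \<in> closed_segment a b\<close> unfolding closed_segment_def by blast
    then show ?thesis using f convex_bound_lt[OF assms(2,3), of "1 - t" t] by simp
  qed
  moreover have "c \<le> f z" if "z \<in> closed_segment x y" for z
  proof -
    obtain t where t: "0 \<le> t" "t \<le> 1" "z = (1 - t) *\<^sub>R x + t *\<^sub>R y"
      using \<open>z \<in> closed_segment x y\<close> unfolding closed_segment_def by blast
    then have "(1 - t) * c + t * c \<le> f z"
      unfolding t(3) f using assms(4,5) by (intro add_mono mult_left_mono) auto
    then show ?thesis by (simp add: algebra_simps)
  qed
  ultimately show ?thesis by force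
qed

definition cturn :: "point \<Rightarrow> point \<Rightarrow> complex \<Rightarrow> real" where
  "cturn p q z = (of_int (fst q - fst p)) * (Im z - of_int (snd p)) -
     (of_int (snd q - snd p)) * (Re z - of_int (fst p))"

lemma cturn_cpoint: "cturn p q (cpoint r) = of_int (turn p q r)"
  unfolding cturn_def cpoint_def turn_def by simp

lemma cturn_affine: "cturn p q ((1 - t) *\<^sub>R x + t *\<^sub>R y) = (1 - t) * cturn p q x + t * cturn p q y"
  unfolding cturn_def by (simp add: algebra_simps)

lemma turn_self: "turn p q p = 0" "turn p q q = 0"
  unfolding turn_def by simp_all

lemma same_side_disjoint: "same_side p q r s \<Longrightarrow> cseg (p, q) \<inter> cseg (r, s) = {}"
proof -
  have "cseg (r, s) \<inter> cseg (p, q) = {}" if "turn p q r < 0" "turn p q s < 0"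
    unfolding cseg_def
    using that by (intro linear_separation[of "cturn p q" _ 0]) (simp_all add: cturn_affine cturn_cpoint turn_self)
  moreover have "cseg (r, s) \<inter> cseg (p, q) = {}" if "turn p q r > 0" "turn p q s > 0"
    unfolding cseg_def
    using that by (intro linear_separation[of "\<lambda>z. - cturn p q z" _ 0])
      (simp_all add: cturn_affine cturn_cpoint turn_self)
  ultimately show "same_side p q r s \<Longrightarrow> cseg (p, q) \<inter> cseg (r, s) = {}"
    unfolding same_side_def by blast
qed

lemma box_disjoint:
  assumes "max (fst p) (fst q) < min (fst r) (fst s) \<or> max (snd p) (snd q) < min (snd r) (snd s)"
  shows "cseg (p, q) \<inter> cseg (r, s) = {}"
  using assms
proof
  assume a: "max (fst p) (fst q) < min (fst r) (fst s)"
  show ?thesis unfolding cseg_def using a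
    by (intro linear_separation[of Re _ "of_int (min (fst r) (fst s))"]) (auto simp: cpoint_def)
next
  assume a: "max (snd p) (snd q) < min (snd r) (snd s)"
  show ?thesis unfolding cseg_def using a
    by (intro linear_separation[of Im _ "of_int (min (snd r) (snd s))"]) (auto simp: cpoint_def)
qed

text \<open>\<open>cturn p q\<close> vanishes on the first segment and changes linearly from 0 at r
  to a nonzero value at s, so the second segment meets the first only in r.\<close>

lemma turn_common_end:
  assumes "turn p q s \<noteq> 0" "r = p \<or> r = q"
  shows "cseg (p, q) \<inter> cseg (r, s) \<subseteq> {cpoint r}"
proof
  fix z assume z: "z \<in> cseg (p, q) \<inter> cseg (r, s)"
  obtain t where t: "z = (1 - t) *\<^sub>R cpoint p + t *\<^sub>R cpoint q"
    using z unfolding cseg_def closed_segment_def by auto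
  obtain u where u: "z = (1 - u) *\<^sub>R cpoint r + u *\<^sub>R cpoint s"
    using z unfolding cseg_def closed_segment_def by auto
  have "cturn p q z = 0" unfolding t cturn_affine by (simp add: cturn_cpoint turn_self)
  moreover have "cturn p q z = u * of_int (turn p q s)"
    unfolding u cturn_affine using assms(2) by (auto simp: cturn_cpoint turn_self)
  ultimately have "u = 0" using assms(1) by simp
  then show "z \<in> {cpoint r}" using u by simp
qed

lemma non_crossing_sound:
  assumes "non_crossing (p, q) (r, s)"
  shows "cseg (p, q) \<inter> cseg (r, s) \<subseteq> cpoint ` ({p, q} \<inter> {r, s})"
proof -
  have comm: "cseg (r, s) = cseg (s, r)" for r s unfolding cseg_def by (simp add: closed_segment_commute)
  consider
      "max (fst p) (fst q) < min (fst r) (fst s) \<or> max (snd p) (snd q) < min (snd r) (snd s)"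
    | "max (fst r) (fst s) < min (fst p) (fst q) \<or> max (snd r) (snd s) < min (snd p) (snd q)"
    | "p = r \<or> q = r" "turn p q s \<noteq> 0" | "p = s \<or> q = s" "turn p q r \<noteq> 0"
    | "same_side p q r s" | "same_side r s p q"
    using assms unfolding non_crossing_def by (simp split: if_splits)
  then show ?thesis
  proof cases
    case 3
    then show ?thesis using turn_common_end[of p q s r] by fastforce
  next
    case 4
    then show ?thesis using turn_common_end[of p q r s] comm[of r s] by fastforce
  qed (use box_disjoint[of p q r s] box_disjoint[of r s p q] same_side_disjoint in blast)+
qed

lemma non_crossing_irrefl: "\<not> non_crossing (p, q) (p, q)"
  unfolding non_crossing_def by (simp add: turn_self)

definition drawn :: "point list \<Rightarrow> (nat \<times> nat) list \<Rightarrow> bool" where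
  "drawn xy A \<longleftrightarrow> distinct xy \<and> sorted_wrt non_crossing (map (\<lambda>(a, b). (xy ! a, xy ! b)) A)"

lemma sorted_wrt_irrefl_distinct:
  "(\<And>x. \<not> R x x) \<Longrightarrow> sorted_wrt R xs \<Longrightarrow> distinct xs"
  by (induction xs) auto

text \<open>No segment passes \<open>non_crossing\<close> against itself, so the pairwise test also
  excludes repeated edges.\<close>

lemma distinct_if_drawn: "drawn xy A \<Longrightarrow> distinct A"
proof -
  assume "drawn xy A"
  then have "distinct (map (\<lambda>(a, b). (xy ! a, xy ! b)) A)"
    unfolding drawn_def using sorted_wrt_irrefl_distinct[of non_crossing] non_crossing_irrefl by auto
  then show ?thesis by (simp add: distinct_map)
qed

definition ends :: "'a \<times> 'b \<times> 'c \<Rightarrow> 'a \<times> 'b" where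
  "ends = (\<lambda>(a, b, w). (a, b))"

lemma sorted_wrt_either:
  "sorted_wrt R xs \<Longrightarrow> x \<in> set xs \<Longrightarrow> y \<in> set xs \<Longrightarrow> x = y \<or> R x y \<or> R y x"
  by (induction xs) auto

lemma straight_drawing_if_drawn:
  assumes E: "edge_list n E" and xy: "length xy = n" "drawn xy (map ends E)"
  shows "straight_drawing {..<n} (edge_weight E) (\<lambda>v. cpoint (xy ! v))"
proof -
  let ?pos = "\<lambda>v. cpoint (xy ! v)"
  have inj: "inj_on ?pos {..<n}"
    using xy unfolding drawn_def by (simp add: inj_on_def nth_eq_iff_index_eq)
  have ordered: "closed_segment (?pos u) (?pos v) \<inter> closed_segment (?pos x) (?pos y) \<subseteq> ?pos ` ({u, v} \<inter> {x, y})"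
    if uv: "(u, v) \<in> set (map ends E)" and ab: "(x, y) \<in> set (map ends E)" and ne: "(u, v) \<noteq> (x, y)"
    for u v x y
  proof -
    have lt: "u < n" "v < n" "x < n" "y < n" using uv ab E unfolding edge_list_def ends_def by fastforce+
    let ?g = "\<lambda>(a, b). (xy ! a, xy ! b)"
    have g_ne: "?g (u, v) \<noteq> ?g (x, y)" using lt ne xy unfolding drawn_def by (auto simp: nth_eq_iff_index_eq)
    have g_in: "?g (u, v) \<in> set (map ?g (map ends E))" "?g (x, y) \<in> set (map ?g (map ends E))"
      unfolding set_map[of ?g] using uv ab by (blast, blast)
    have "sorted_wrt non_crossing (map ?g (map ends E))" using xy(2) unfolding drawn_def by blast
    from sorted_wrt_either[OF this g_in] g_ne
    have "non_crossing (?g (u, v)) (?g (x, y)) \<or> non_crossing (?g (x, y)) (?g (u, v))" by argo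
    then have "cseg (xy ! u, xy ! v) \<inter> cseg (xy ! x, xy ! y) \<subseteq> cpoint ` ({xy ! u, xy ! v} \<inter> {xy ! x, xy ! y})"
      using non_crossing_sound[of "xy ! u" "xy ! v" "xy ! x" "xy ! y"]
        non_crossing_sound[of "xy ! x" "xy ! y" "xy ! u" "xy ! v"] by auto
    also have "{xy ! u, xy ! v} \<inter> {xy ! x, xy ! y} = (!) xy ` ({u, v} \<inter> {x, y})"
      using lt xy unfolding drawn_def by (auto simp: nth_eq_iff_index_eq)
    finally show ?thesis unfolding cseg_def by (simp add: image_image)
  qed
  show ?thesis
    unfolding straight_drawing_def
  proof (intro conjI allI impI)
    fix u v x y
    assume a: "0 < edge_weight E u v \<and> 0 < edge_weight E x y \<and> {u, v} \<noteq> {x, y}"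
    have e: "(u, v) \<in> set (map ends E) \<or> (v, u) \<in> set (map ends E)" if "0 < edge_weight E u v" for u v
      using edge_weight_nonzeroD[of E u v] that unfolding ends_def by force
    from a e[of u v] e[of x y]
    \<comment> \<open>The list has each edge in one orientation only, while a drawing speaks of
      both.\<close>
    consider "(u, v) \<in> set (map ends E)" "(x, y) \<in> set (map ends E)"
      | "(u, v) \<in> set (map ends E)" "(y, x) \<in> set (map ends E)"
      | "(v, u) \<in> set (map ends E)" "(x, y) \<in> set (map ends E)"
      | "(v, u) \<in> set (map ends E)" "(y, x) \<in> set (map ends E)" by blast
    then show "closed_segment (?pos u) (?pos v) \<inter> closed_segment (?pos x) (?pos y) \<subseteq> ?pos ` ({u, v} \<inter> {x, y})"
    proof cases
      case 1
      then show ?thesis using ordered[of u v x y] a by auto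
    next
      case 2
      have "(u, v) \<noteq> (y, x)" using a by auto
      from ordered[OF 2 this] show ?thesis
        by (simp only: closed_segment_commute[of "?pos y"] insert_commute[of y])
    next
      case 3
      have "(v, u) \<noteq> (x, y)" using a by auto
      from ordered[OF 3 this] show ?thesis
        by (simp only: closed_segment_commute[of "?pos v"] insert_commute[of v])
    next
      case 4
      have "(v, u) \<noteq> (y, x)" using a by auto
      from ordered[OF 4 this] show ?thesis
        by (simp only: closed_segment_commute[of "?pos v"] insert_commute[of v]
            closed_segment_commute[of "?pos y"] insert_commute[of y])
    qed
  qed (rule inj)
qed

section \<open>Executable certificates for distances\<close>

definition real_edges :: "('a \<times> 'a \<times> nat) list \<Rightarrow> ('a \<times> 'a \<times> real) list" where
  "real_edges = map (\<lambda>(a, b, w). (a, b, real w))"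

lemma map_ends_real_edges: "map ends (real_edges E) = map ends E"
  unfolding real_edges_def ends_def by (simp add: case_prod_beta)

definition grid_edges :: "nat \<Rightarrow> (nat \<times> nat \<times> nat) list \<Rightarrow> bool" where
  "grid_edges n E \<longleftrightarrow> 0 < n \<and> list_all (\<lambda>(a, b, w). a < b \<and> b < n \<and> 0 < w) E \<and>
     list_all (\<lambda>v. v = 0 \<or> list_ex (\<lambda>(a, b, w). b = v) E) [0..<n]"

lemma edge_list_real_edges:
  assumes "grid_edges n E" "drawn xy (map ends E)"
  shows "edge_list n (real_edges E)"
proof -
  have "map (\<lambda>(a, b, w). (a, b)) (real_edges E) = map ends E"
    using map_ends_real_edges[of E] unfolding ends_def .
  then have "distinct (map (\<lambda>(a, b, w). (a, b)) (real_edges E))"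
    using distinct_if_drawn[OF assms(2)] by simp
  moreover have "v = 0 \<or> v \<in> (\<lambda>(a, b, w). b) ` set (real_edges E)" if v: "v < n" for v
  proof -
    have "v = 0 \<or> list_ex (\<lambda>(a, b, w). b = v) E"
      using assms(1) v unfolding grid_edges_def list_all_iff by simp
    then show ?thesis unfolding real_edges_def list_ex_iff by force
  qed
  moreover have "\<forall>(a, b, w)\<in>set (real_edges E). a < b \<and> b < n \<and> 0 < w" "0 < n"
    using assms(1) unfolding grid_edges_def real_edges_def list_all_iff by auto
  ultimately show ?thesis unfolding edge_list_def by blast
qed

text \<open>Row v of the table lists the distances from v to the centers x_0, x_1, ...\<close>

definition lipschitz_table :: "nat list list \<Rightarrow> (nat \<times> nat \<times> nat) list \<Rightarrow> bool" where
  "lipschitz_table T = list_all (\<lambda>(a, b, w). list_all2 (\<lambda>s t. s \<le> t + w \<and> t \<le> s + w) (T ! a) (T ! b))"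

definition neighbours :: "(nat \<times> nat \<times> nat) list \<Rightarrow> nat \<Rightarrow> (nat \<times> nat) list" where
  "neighbours E v =
     map (\<lambda>(a, b, w). (if a = v then b else a, w)) (filter (\<lambda>(a, b, w). a = v \<or> b = v) E)"

text \<open>All columns are checked in one pass: \<open>ts\<close> is the row of v, and
  \<open>nbs\<close> holds the rows of its neighbours, already increased by the weights of the
  connecting edges.\<close>

primrec descends :: "nat \<Rightarrow> nat list \<Rightarrow> nat list \<Rightarrow> nat list list \<Rightarrow> bool" where
  "descends v [] ts nbs \<longleftrightarrow> True"
| "descends v (x # xs) ts nbs \<longleftrightarrow>
     (v = x \<or> list_ex (\<lambda>r. hd r \<le> hd ts) nbs) \<and> descends v xs (tl ts) (map tl nbs)"

text \<open>Weights are positive, so the entry drops with every step to such a neighbour; the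
  descent ends at the center, at a cost of at most the entry. With \<open>lipschitz_table\<close>
  and entries 0 at the centers, the table gives the exact distances.\<close>

definition descending_table :: "nat list \<Rightarrow> nat list list \<Rightarrow> (nat \<times> nat \<times> nat) list \<Rightarrow> bool" where
  "descending_table xs T E = list_all (\<lambda>v. descends v xs (T ! v)
     (map (\<lambda>(u, w). map ((+) w) (T ! u)) (neighbours E v))) [0..<length T]"

definition separating_table :: "nat \<Rightarrow> nat \<Rightarrow> nat list \<Rightarrow> nat list \<Rightarrow> nat list list \<Rightarrow> bool" where
  "separating_table A L ps xs T \<longleftrightarrow> list_all (\<lambda>r. length r = length xs) T \<and> length ps = length xs \<and>
     list_all (\<lambda>v. v < length T) ps \<and> list_all (\<lambda>v. v < length T) xs \<and> distinct ps \<and>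
     list_all (\<lambda>i. T ! (xs ! i) ! i = 0 \<and>
       list_all (\<lambda>j. if i = j then L \<le> T ! (ps ! j) ! i else T ! (ps ! j) ! i \<le> A) [0..<length ps]) [0..<length xs]"

lemma descends_nth:
  assumes "descends v xs ts nbs" "i < length xs" "length ts = length xs"
    and "\<And>r. r \<in> set nbs \<Longrightarrow> length r = length xs"
  shows "v = xs ! i \<or> (\<exists>r\<in>set nbs. r ! i \<le> ts ! i)"
  using assms
proof (induction xs arbitrary: ts nbs i)
  case (Cons x xs)
  show ?case
  proof (cases i)
    case 0
    have "hd r = r ! 0" if "r \<in> set nbs" for r using Cons.prems(4)[OF that] by (cases r) auto
    moreover have "hd ts = ts ! 0" using Cons.prems(3) by (cases ts) auto
    ultimately show ?thesis using Cons.prems(1) 0 by (auto simp: list_ex_iff)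
  next
    case (Suc j)
    have "v = xs ! j \<or> (\<exists>r\<in>set (map tl nbs). r ! j \<le> tl ts ! j)"
      using Cons.prems Suc by (intro Cons.IH) auto
    moreover have "tl r ! j = r ! i" if "r \<in> set nbs" for r
      using Cons.prems(2,4) that Suc by (intro trans[OF nth_tl]) auto
    moreover have "tl ts ! j = ts ! i" using Cons.prems(2,3) Suc by (intro trans[OF nth_tl]) auto
    ultimately show ?thesis using Suc by auto
  qed
qed simp

locale distance_table =
  fixes E :: "(nat \<times> nat \<times> nat) list" and xy :: "point list" and ps xs :: "nat list"
    and T :: "nat list list" and A L :: nat
  assumes edges: "grid_edges (length T) E" and xy: "length xy = length T" "drawn xy (map ends E)"
    and lip: "lipschitz_table T E" and desc: "descending_table xs T E"
    and sep: "separating_table A L ps xs T" and AL: "A < L"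
begin

abbreviation "n \<equiv> length T"
abbreviation "W \<equiv> edge_weight (real_edges E)"

lemma edge_list: "edge_list n (real_edges E)"
  by (rule edge_list_real_edges[OF edges xy(2)])

lemma row_length: "v < n \<Longrightarrow> length (T ! v) = length xs"
  using sep unfolding separating_table_def list_all_iff by simp

lemma lower:
  assumes "reach W u v c" "i < length xs"
  shows "real (T ! u ! i) - real (T ! v ! i) \<le> c"
proof (rule reach_edge_list_potential[OF _ assms(1), where \<phi> = "\<lambda>v. real (T ! v ! i)"])
  fix a b w assume "(a, b, w) \<in> set (real_edges E)"
  then obtain w' where e: "(a, b, w') \<in> set E" "w = real w'" unfolding real_edges_def by auto
  have "a < n" using edges e(1) unfolding grid_edges_def list_all_iff by auto
  have "list_all2 (\<lambda>s t. s \<le> t + w' \<and> t \<le> s + w') (T ! a) (T ! b)"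
    using lip e(1) unfolding lipschitz_table_def list_all_iff by auto
  then have "T ! a ! i \<le> T ! b ! i + w' \<and> T ! b ! i \<le> T ! a ! i + w'"
    using list_all2_nthD assms(2) row_length[OF \<open>a < n\<close>] by fastforce
  then show "real (T ! a ! i) \<le> real (T ! b ! i) + w \<and> real (T ! b ! i) \<le> real (T ! a ! i) + w"
    using e(2) by linarith
qed

lemma upper:
  assumes "i < length xs"
  shows "v < n \<Longrightarrow> \<exists>c\<le>real (T ! v ! i). reach W v (xs ! i) c"
proof (induction "T ! v ! i" arbitrary: v rule: less_induct)
  case less
  let ?nbs = "map (\<lambda>(u, w). map ((+) w) (T ! u)) (neighbours E v)"
  have nb: "u < n \<and> 0 < w \<and> ((u, v, w) \<in> set E \<or> (v, u, w) \<in> set E)"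
    if "(u, w) \<in> set (neighbours E v)" for u w
    using that edges less.prems unfolding neighbours_def grid_edges_def list_all_iff
    by (auto split: if_splits)
  have "descends v xs (T ! v) ?nbs"
    using desc less.prems unfolding descending_table_def list_all_iff by simp
  then have "v = xs ! i \<or> (\<exists>r\<in>set ?nbs. r ! i \<le> T ! v ! i)"
    using assms row_length less.prems nb by (intro descends_nth) auto
  then show ?case
  proof
    assume "v = xs ! i"
    then show ?thesis using reach_refl[of W v] by (intro exI[of _ 0]) auto
  next
    assume "\<exists>r\<in>set ?nbs. r ! i \<le> T ! v ! i"
    then obtain u w where uw: "(u, w) \<in> set (neighbours E v)" "map ((+) w) (T ! u) ! i \<le> T ! v ! i"
      by auto
    note nb = nb[OF uw(1)]
    have le: "w + T ! u ! i \<le> T ! v ! i" using uw(2) row_length[of u] nb assms by simp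
    then obtain c where c: "c \<le> real (T ! u ! i)" "reach W u (xs ! i) c"
      using less.hyps[of u] nb by auto
    have "W v u = real w"
    proof -
      have "(u, v, real w) \<in> set (real_edges E) \<or> (v, u, real w) \<in> set (real_edges E)"
        using nb unfolding real_edges_def by force
      then show ?thesis using edge_weight_eq[OF edge_list] by blast
    qed
    then have "reach W v (xs ! i) (real w + c)"
      using reach_step[of W v u "xs ! i" c] c(2) nb by simp
    then show ?thesis using c(1) le by (intro exI[of _ "real w + c"]) auto
  qed
qed

text \<open>Division by L - A turns the difference between far and near into the gap 1 of
  \<open>hard_points\<close>.\<close>

definition "scaled_weight u v = W u v / real (L - A)"

lemma scaled_weight_alt: "scaled_weight = (\<lambda>u v. (1 / real (L - A)) * W u v)"
  unfolding scaled_weight_def by auto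

lemma net_scaled: "net {..<n} scaled_weight"
  unfolding scaled_weight_alt using AL by (intro net_scale net_edge_weight edge_list) simp

lemma straight_drawing_scaled: "straight_drawing {..<n} scaled_weight (\<lambda>v. cpoint (xy ! v))"
  unfolding scaled_weight_alt using AL
  by (intro straight_drawing_scale straight_drawing_if_drawn edge_list xy(1))
    (use xy(2) in \<open>simp_all add: map_ends_real_edges\<close>)

text \<open>The i-th center alone is the witness for the i-th point. Reserving h later levels adds h
  to all distances and to the number of centers.\<close>

lemma hard_points_scaled:
  "hard_points {..<n} scaled_weight (set ps) (\<lambda>_. h) (Suc h) (real h + real A / real (L - A))"
  unfolding hard_points_def
proof (intro conjI ballI)
  let ?g = "real (L - A)"
  have g: "?g > 0" "1 / ?g > 0" "?g = real L - real A" using AL by simp_all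
  have ps: "set ps \<subseteq> {..<n}" "length ps = length xs" and xs: "set xs \<subseteq> {..<n}"
    using sep unfolding separating_table_def list_all_iff by auto
  show "set ps \<subseteq> {..<n}" by (rule ps)
  have T: "T ! (xs ! i) ! i = 0" "i = j \<Longrightarrow> L \<le> T ! (ps ! j) ! i"
    "i \<noteq> j \<Longrightarrow> T ! (ps ! j) ! i \<le> A" if "i < length xs" "j < length xs" for i j
    using sep that unfolding separating_table_def list_all_iff by (auto split: if_splits)
  have scale: "reach scaled_weight u v c \<longleftrightarrow> reach W u v (c * ?g)" for u v c
    using reach_scale[OF g(2), of W u v "c * ?g"] g(1) unfolding scaled_weight_alt by simp
  fix p assume "p \<in> set ps"
  then obtain i where i: "i < length xs" "p = ps ! i" using ps(2) by (metis in_set_conv_nth)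
  show "\<exists>X\<subseteq>{..<n}. card X + h \<le> Suc h \<and>
    (\<forall>x\<in>X. \<forall>c. reach scaled_weight p x c \<longrightarrow> real h + real A / ?g + 1 \<le> c + real h) \<and>
    (\<forall>q\<in>set ps - {p}. \<exists>x\<in>X. \<exists>c. reach scaled_weight q x c \<and> c + real h \<le> real h + real A / ?g)"
  proof (intro exI[of _ "{xs ! i}"] conjI ballI allI impI)
    show "{xs ! i} \<subseteq> {..<n}" using xs i by (auto intro: nth_mem)
    show "card {xs ! i} + h \<le> Suc h" by simp
  next
    fix x c assume "x \<in> {xs ! i}" "reach scaled_weight p x c"
    then have "real L \<le> c * ?g" using lower[of p x "c * ?g" i] T(1,2)[OF i(1) i(1)] i scale by auto
    then have "real L / ?g \<le> c" using g(1) by (simp add: field_simps)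
    moreover have "real L / ?g = real A / ?g + 1"
      using g(1) unfolding g(3) by (simp add: diff_divide_distrib[symmetric] field_simps)
    ultimately show "real h + real A / ?g + 1 \<le> c + real h" by simp
  next
    fix q assume q: "q \<in> set ps - {p}"
    then obtain j where j: "j < length xs" "q = ps ! j" using ps(2) by (metis DiffD1 in_set_conv_nth)
    then have "i \<noteq> j" using q i by auto
    have "q < n" using q ps(1) by auto
    then obtain c where c: "c \<le> real (T ! q ! i)" "reach W q (xs ! i) c" using upper[OF i(1)] by blast
    have "T ! q ! i \<le> A" using T(3)[OF i(1) j(1) \<open>i \<noteq> j\<close>] j(2) by simp
    then have "c \<le> real A" using c(1) by simp
    then have "c / ?g \<le> real A / ?g" using g(1) by (simp add: divide_right_mono)
    moreover have "reach scaled_weight q (xs ! i) (c / ?g)" using c(2) g(1) scale by simp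
    ultimately show "\<exists>x\<in>{xs ! i}. \<exists>c. reach scaled_weight q x c \<and> c + real h \<le> real h + real A / ?g"
      by auto
  qed
qed

lemma card_points: "card (set ps) = length ps"
  using sep unfolding separating_table_def by (simp add: distinct_card)

end

section \<open>The splitters\<close>

text \<open>
  Vertex 0 is the root, 3, 4, 7, 8 are the ports and 6, 5, 1, 2 their opposite vertices in the cube
  1-8; the centers 9, ..., 12 hang at the latter.
\<close>

definition cube_splitter :: "real \<Rightarrow> (nat \<times> nat \<times> real) list" where
  "cube_splitter a = [(0, 1, 1/2), (0, 2, 1/2), (1, 3, 1/2), (2, 3, 1/2), (1, 4, 1/2), (2, 4, 1/2),
     (3, 5, 1/2), (4, 6, 1/2), (2, 7, 1/2), (5, 7, 1/2), (6, 7, 1/2), (1, 8, 1/2), (5, 8, 1/2),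
     (6, 8, 1/2), (6, 9, a - 1/2), (5, 10, a - 1/2), (1, 11, a - 1/2), (2, 12, a - 1/2)]"

definition cube_splitter_points :: "point list" where
  "cube_splitter_points = [(0, 0), (10, 8), (10, -8), (4, 0), (16, 0), (8, 0), (12, 0), (10, -2),
     (10, 2), (10, -1), (10, 1), (11, 10), (11, -10)]"

definition cube_center :: "nat \<Rightarrow> nat" where
  "cube_center s = (if s = 3 then 9 else if s = 4 then 10 else if s = 7 then 11 else 12)"

text \<open>Crossings do not depend on the symbolic weight a; \<open>ends\<close> strips it, after
  which the test can be evaluated.\<close>

lemma drawn_cube_splitter: "drawn cube_splitter_points (map ends (cube_splitter a))"
proof -
  have "map ends (cube_splitter a) = [(0, 1), (0, 2), (1, 3), (2, 3), (1, 4), (2, 4),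
     (3, 5), (4, 6), (2, 7), (5, 7), (6, 7), (1, 8), (5, 8), (6, 8), (6, 9), (5, 10), (1, 11), (2, 12)]"
    by (simp add: cube_splitter_def ends_def)
  moreover have "drawn cube_splitter_points [(0, 1), (0, 2), (1, 3), (2, 3), (1, 4), (2, 4),
     (3, 5), (4, 6), (2, 7), (5, 7), (6, 7), (1, 8), (5, 8), (6, 8), (6, 9), (5, 10), (1, 11), (2, 12)]"
    by code_simp
  ultimately show ?thesis by simp
qed

lemma edge_list_cube_splitter:
  assumes "1 / 2 < a"
  shows "edge_list 13 (cube_splitter a)"
  unfolding edge_list_def
proof (intro conjI)
  show "\<forall>(u, v, w)\<in>set (cube_splitter a). u < v \<and> v < 13 \<and> 0 < w"
    using assms by (simp add: cube_splitter_def)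
  show "distinct (map (\<lambda>(a, b, w). (a, b)) (cube_splitter a))"
    using distinct_if_drawn[OF drawn_cube_splitter] unfolding ends_def .
  show "\<forall>v<13. v = 0 \<or> v \<in> (\<lambda>(a, b, w). b) ` set (cube_splitter a)"
    by (simp add: cube_splitter_def all_less_numeral)
qed simp

lemma rooted_drawing_cube_splitter:
  assumes "1 / 2 < a"
  shows "straight_drawing {..<13} (edge_weight (cube_splitter a)) (\<lambda>v. cpoint (cube_splitter_points ! v))"
    and "cpoint (cube_splitter_points ! 0) = 0"
    and "v \<in> {..<13} - {0} \<Longrightarrow> 0 < Re (cpoint (cube_splitter_points ! v))"
proof -
  show "straight_drawing {..<13} (edge_weight (cube_splitter a)) (\<lambda>v. cpoint (cube_splitter_points ! v))"
    by (intro straight_drawing_if_drawn edge_list_cube_splitter assms drawn_cube_splitter)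
      (simp add: cube_splitter_points_def)
  show "cpoint (cube_splitter_points ! 0) = 0"
    by (simp add: cpoint_def cube_splitter_points_def complex_eq_iff)
  have "\<forall>v<13. v \<noteq> 0 \<longrightarrow> 0 < fst (cube_splitter_points ! v)"
    by (simp add: cube_splitter_points_def all_less_numeral)
  then show "v \<in> {..<13} - {0} \<Longrightarrow> 0 < Re (cpoint (cube_splitter_points ! v))"
    by (simp add: cpoint_def)
qed

lemma reach_two_edges:
  assumes "W u x > 0" "W x v > 0"
  shows "reach W u v (W u x + W x v)"
  using reach_step[of W u x v "W x v"] reach_edge[of W x v] assms by simp

text \<open>A port is at distance 3/2 from its opposite vertex and 1/2 from those of the other
  ports; a center edge of weight a - 1/2 turns this into a + 1 and a. Each port is adjacent to 1 or
  2 and so at distance 1 from the root, which opens no shortcut, as 1 and 2 already share the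
  neighbours 3 and 4.\<close>

lemma splitter_cube:
  assumes a: "1 / 2 < a"
  shows "splitter {..<13} (edge_weight (cube_splitter a)) 0 {3, 4, 7, 8} cube_center a"
proof -
  let ?W = "edge_weight (cube_splitter a)"
  have up: "\<exists>c\<le>b. reach ?W u v c" if "?W u x > 0" "?W x v > 0" "?W u x + ?W x v \<le> b" for u x v b
    using reach_two_edges[of ?W, OF that(1,2)] that(3) by blast
  have low: "b \<le> c" if "reach ?W u v c" "b \<le> \<phi> u - \<phi> v"
    "\<forall>(u, v, w)\<in>set (cube_splitter a). \<phi> u \<le> \<phi> v + w \<and> \<phi> v \<le> \<phi> u + w" for \<phi> u v b c
    using reach_edge_list_potential[of "cube_splitter a" \<phi> u v c] that by force
  have r1: "\<exists>c\<le>1. reach ?W s 0 c" if "s \<in> {3, 4, 7, 8}" for s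
    using that up[of s 1 0 1] up[of s 2 0 1] by (auto simp: cube_splitter_def)
  have r2: "1 \<le> c" if "s \<in> {3, 4, 7, 8}" "reach ?W s 0 c" for s c
    by (rule low[OF that(2), where \<phi> = "\<lambda>v. [0, 1, 1, 2, 2, 3, 3, 2, 2, 3, 3, 1, 1] ! v / 2"])
      (use that(1) a in \<open>auto simp: cube_splitter_def\<close>)
  \<comment> \<open>Here and in the next three potentials the list counts edges to the opposite
    vertex of the port, halved for the length; the center there gets a negative value, and the other
    centers copy the vertex at which they hang.\<close>
  have f3: "a + 1 \<le> c" if "reach ?W 3 9 c" for c
    by (rule low[OF that, where \<phi> = "\<lambda>v. if v = 9 then 1/2 - a else [3, 2, 2, 3, 1, 2, 0, 1, 1, 0, 2, 2, 2] ! v / 2"])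
      (use a in \<open>auto simp: cube_splitter_def\<close>)
  have f4: "a + 1 \<le> c" if "reach ?W 4 10 c" for c
    by (rule low[OF that, where \<phi> = "\<lambda>v. if v = 10 then 1/2 - a else [3, 2, 2, 1, 3, 0, 2, 1, 1, 2, 0, 2, 2] ! v / 2"])
      (use a in \<open>auto simp: cube_splitter_def\<close>)
  have f7: "a + 1 \<le> c" if "reach ?W 7 11 c" for c
    by (rule low[OF that, where \<phi> = "\<lambda>v. if v = 11 then 1/2 - a else [1, 0, 2, 1, 1, 2, 2, 3, 1, 2, 2, 0, 2] ! v / 2"])
      (use a in \<open>auto simp: cube_splitter_def\<close>)
  have f8: "a + 1 \<le> c" if "reach ?W 8 12 c" for c
    by (rule low[OF that, where \<phi> = "\<lambda>v. if v = 12 then 1/2 - a else [1, 2, 0, 1, 1, 2, 2, 1, 3, 2, 2, 2, 0] ! v / 2"])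
      (use a in \<open>auto simp: cube_splitter_def\<close>)
  have near: "\<exists>c\<le>a. reach ?W s' (cube_center s) c"
    if "s \<in> {3, 4, 7, 8}" "s' \<in> {3, 4, 7, 8} - {s}" for s s'
    using that up[of s' 6 9 a] up[of s' 5 10 a] up[of s' 1 11 a] up[of s' 2 12 a] a
    by (auto simp: cube_splitter_def cube_center_def)
  have "net {..<13} ?W" by (rule net_edge_weight[OF edge_list_cube_splitter[OF a]])
  moreover have "\<forall>s\<in>{3, 4, 7, 8}. \<forall>c. reach ?W s (cube_center s) c \<longrightarrow> a + 1 \<le> c"
    using f3 f4 f7 f8 by (simp add: cube_center_def)
  ultimately show ?thesis unfolding splitter_def using r1 r2 near
    by (auto simp: cube_center_def)
qed

lemma straight_drawing_relabel:
  assumes net: "net V W" and inj: "inj_on f V" and draw: "straight_drawing V W pos"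
  shows "straight_drawing (f ` V) (relabel V f W) (\<lambda>u. pos (inv_into V f u))"
  unfolding straight_drawing_def
proof (intro conjI allI impI)
  let ?g = "inv_into V f"
  have g: "?g (f x) = x" if "x \<in> V" for x using inj that by simp
  show "inj_on (\<lambda>u. pos (?g u)) (f ` V)"
    using draw g unfolding straight_drawing_def inj_on_def by auto
  fix u v x y
  assume a: "0 < relabel V f W u v \<and> 0 < relabel V f W x y \<and> {u, v} \<noteq> {x, y}"
  obtain u' v' where uv: "u' \<in> V" "v' \<in> V" "u = f u'" "v = f v'" "W u' v' > 0"
    using relabel_posD[OF net inj] a by blast
  obtain x' y' where xy: "x' \<in> V" "y' \<in> V" "x = f x'" "y = f y'" "W x' y' > 0"
    using relabel_posD[OF net inj] a by blast
  have "{u', v'} \<noteq> {x', y'}" using a uv(3,4) xy(3,4) by (metis image_empty image_insert)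
  then have "closed_segment (pos u') (pos v') \<inter> closed_segment (pos x') (pos y') \<subseteq> pos ` ({u', v'} \<inter> {x', y'})"
    using draw uv(5) xy(5) unfolding straight_drawing_def by blast
  also have "\<dots> \<subseteq> (\<lambda>u. pos (?g u)) ` ({u, v} \<inter> {x, y})"
  proof
    fix z assume "z \<in> pos ` ({u', v'} \<inter> {x', y'})"
    then obtain w where w: "w \<in> {u', v'}" "w \<in> {x', y'}" "z = pos w" by blast
    then have "f w \<in> {u, v} \<inter> {x, y}" "?g (f w) = w" using g uv xy by auto
    then show "z \<in> (\<lambda>u. pos (?g u)) ` ({u, v} \<inter> {x, y})" using w(3) by (metis imageI)
  qed
  finally show "closed_segment (pos (?g u)) (pos (?g v)) \<inter> closed_segment (pos (?g x)) (pos (?g y))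
      \<subseteq> (\<lambda>u. pos (?g u)) ` ({u, v} \<inter> {x, y})"
    using g uv xy by simp
qed

text \<open>Supplies the hypothesis \<open>split\<close> of \<open>split_all_points\<close> for B =
  4. The cube is drawn with its root leftmost, as the gluing of drawings demands.\<close>

lemma ex_cube_split:
  fixes V :: "nat set"
  assumes net: "net V W" and draw: "straight_drawing V W pos" and p: "p \<in> V" and a: "1 / 2 < a"
  shows "\<exists>V' W' S z. splitter V' W' p S z a \<and> card S = 4 \<and> V \<inter> V' = {p} \<and>
    (\<exists>pos. straight_drawing (V \<union> V') (glue W W') pos)"
proof -
  let ?V = "{..<13} :: nat set" and ?W = "edge_weight (cube_splitter a)"
  let ?pos = "\<lambda>v. cpoint (cube_splitter_points ! v)"
  note D = rooted_drawing_cube_splitter[OF a]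
  have net': "net ?V ?W" by (rule net_edge_weight[OF edge_list_cube_splitter[OF a]])
  obtain f where f: "inj_on f ?V" "f 0 = p" "V \<inter> f ` ?V = {p}"
    using ex_fresh_labels[OF netD(1)[OF net] p, of 0 ?V] by auto
  have g: "inv_into ?V f (f v) = v" if "v < 13" for v using f(1) that by simp
  have sp: "splitter (f ` ?V) (relabel ?V f ?W) p (f ` {3, 4, 7, 8})
      (\<lambda>u. f (cube_center (inv_into ?V f u))) a"
    using splitter_relabel[OF net' f(1) splitter_cube[OF a]] unfolding f(2) .
  have "inj_on f {3, 4, 7, 8}" by (rule inj_on_subset[OF f(1)]) auto
  then have "card (f ` {3, 4, 7, 8}) = 4" by (simp add: card_image)
  moreover have "\<exists>pos. straight_drawing (V \<union> f ` ?V) (glue W (relabel ?V f ?W)) pos"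
  proof (rule straight_drawing_glue[OF net net_relabel[OF net' f(1)] f(3) draw
        straight_drawing_relabel[OF net' f(1) D(1)]])
    show "?pos (inv_into ?V f p) = 0" using D(2) g[of 0] f(2) by simp
    show "0 < Re (?pos (inv_into ?V f v))" if v: "v \<in> f ` ?V - {p}" for v
    proof -
      obtain u where "u < 13" "v = f u" using v by auto
      moreover from this have "u \<noteq> 0" using v f(2) by (metis DiffD2 singletonI)
      ultimately show ?thesis using D(3)[of u] g[of u] by simp
    qed
  qed
  ultimately show ?thesis using sp f(3) by blast
qed

lemma parented_relabel:
  assumes net: "net V W" and inj: "inj_on f V" and "parented W h"
  shows "parented (relabel V f W) (\<lambda>u. h (inv_into V f u))"
  unfolding parented_def
proof (intro allI impI)
  have g: "inv_into V f (f x) = x" if "x \<in> V" for x using inj that by simp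
  fix v u u'
  assume a: "0 < relabel V f W v u \<and> 0 < relabel V f W v u' \<and>
    h (inv_into V f u) \<le> h (inv_into V f v) \<and> h (inv_into V f u') \<le> h (inv_into V f v)"
  obtain x y where xy: "x \<in> V" "y \<in> V" "v = f x" "u = f y" "W x y > 0"
    using relabel_posD[OF net inj] a by blast
  obtain x' y' where xy': "x' \<in> V" "y' \<in> V" "v = f x'" "u' = f y'" "W x' y' > 0"
    using relabel_posD[OF net inj] a by blast
  have "x' = x" using xy xy' inj_onD[OF inj] by metis
  then have "y = y'" using \<open>parented W h\<close> a xy xy' g unfolding parented_def by metis
  then show "u = u'" using xy xy' by simp
qed

lemma ex_tree_split:
  fixes V :: "nat set"
  assumes net: "net V W" and h: "parented W h" and p: "p \<in> V" and a: "0 < a"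
  shows "\<exists>V' W' S z. splitter V' W' p S z a \<and> card S = 2 \<and> V \<inter> V' = {p} \<and>
    (\<exists>h. parented (glue W W') h)"
proof -
  let ?V = "{..<5} :: nat set" and ?W = "edge_weight (tree_splitter a)"
  have net': "net ?V ?W" by (rule net_edge_weight[OF edge_list_tree_splitter[OF a]])
  obtain f where f: "inj_on f ?V" "f 0 = p" "V \<inter> f ` ?V = {p}"
    using ex_fresh_labels[OF netD(1)[OF net] p, of 0 ?V] by auto
  have g: "inv_into ?V f (f v) = v" if "v < 5" for v using f(1) that by simp
  have sp: "splitter (f ` ?V) (relabel ?V f ?W) p (f ` {1, 2})
      (\<lambda>u. f ((\<lambda>s. if s = 1 then 3 else 4) (inv_into ?V f u))) a"
    using splitter_relabel[OF net' f(1) splitter_tree[OF a]] unfolding f(2) .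
  have "inj_on f {1, 2}" by (rule inj_on_subset[OF f(1)]) auto
  then have "card (f ` {1, 2}) = 2" by (simp add: card_image)
  moreover
  \<comment> \<open>Depth below the root: 1 for the ports, 2 for the centers.\<close>
  let ?h = "\<lambda>v::nat. if v = 0 then 0 else if v \<le> 2 then 1 else 2 :: nat"
  have "parented ?W ?h"
    unfolding parented_def tree_splitter_def by (auto split: if_splits)
  note h' = parented_relabel[OF net' f(1) this]
  have "?h (inv_into ?V f p) < ?h (inv_into ?V f v)" if v: "v \<in> f ` ?V - {p}" for v
  proof -
    obtain u where u: "u < 5" "v = f u" using v by auto
    moreover from this have "u \<noteq> 0" using v f(2) by (metis DiffD2 singletonI)
    moreover have "inv_into ?V f p = 0" using g[of 0] f(2) by simp
    ultimately show ?thesis using g[of u] by simp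
  qed
  from parented_glue[OF net net_relabel[OF net' f(1)] f(3) h h' this]
  have "\<exists>h. parented (glue W (relabel ?V f ?W)) h" by blast
  ultimately show ?thesis using sp f(3) by blast
qed

section \<open>Lower bounds from the tables\<close>

lemma ex_coreset_instance:
  assumes net: "net V W" and hard: "hard_points V W P (\<lambda>_. 0) k D" and card: "2 \<le> card P"
    and \<epsilon>: "0 < \<epsilon>" "\<epsilon> < 1" "D + 1 < 1 / \<epsilon>"
  shows "\<exists>d. (\<forall>u\<in>V. \<forall>v\<in>V. d u v = sp_dist (graph_of V W) (\<lambda>(x, y). W x y) u v) \<and>
    P \<subseteq> V \<and> P \<noteq> {} \<and> (\<forall>Q. kcenter_coreset V d k \<epsilon> P Q \<longrightarrow> card Q = card P)"
proof (intro exI conjI)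
  show "P \<subseteq> V" using hard unfolding hard_points_def by blast
  show "P \<noteq> {}" using card by auto
  show "\<forall>Q. kcenter_coreset V (sp_dist (graph_of V W) (\<lambda>(x, y). W x y)) k \<epsilon> P Q \<longrightarrow> card Q = card P"
    using coreset_eq_if_hard_points[OF net hard _ card \<epsilon>] by blast
qed blast

lemma tree_instance:
  assumes "0 < k" "0 < \<epsilon>" "\<epsilon> < 1" "real k + 1 < 1 / \<epsilon>"
  shows "\<exists>(V :: nat set) d P. tree_metric V d \<and> P \<subseteq> V \<and> P \<noteq> {} \<and>
    (\<forall>Q. kcenter_coreset V d k \<epsilon> P Q \<longrightarrow> card Q = 2 ^ k)"
proof -
  let ?W = "\<lambda>u v :: nat. 0 :: real"
  have net0: "net {0} ?W" unfolding net_def using reach_refl[of ?W 0] by auto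
  \<comment> \<open>One vertex with k levels to come: the empty center set is a witness, since there
    is no other point to serve.\<close>
  have hard0: "hard_points {0} ?W {0} (\<lambda>_. k) k (real k)"
    unfolding hard_points_def by (auto intro!: exI[of _ "{}"])
  have par0: "\<exists>h. parented ?W h" unfolding parented_def by simp
  have split: "\<exists>V' W' S z. splitter V' W' p S z (real k - real m) \<and> card S = 2 \<and> V \<inter> V' = {p} \<and>
      (\<exists>h. parented (glue W W') h)"
    if a: "net V W" "\<exists>h. parented W h" "p \<in> V" "m < k" for V :: "nat set" and W p m
  proof -
    obtain h where "parented W h" using a(2) by blast
    from ex_tree_split[OF a(1) this a(3)] show ?thesis using a(4) by simp
  qed
  from split_all_points[where Q = "\<lambda>V W. \<exists>h. parented W h", OF split _ net0 par0 hard0]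
  have "\<exists>(V :: nat set) W P. net V W \<and> (\<exists>h. parented W h) \<and>
      hard_points V W P (\<lambda>_. 0) k (real k) \<and> card P = 2 ^ k" by simp
  then obtain V :: "nat set" and W P where V: "net V W" "\<exists>h. parented W h"
    "hard_points V W P (\<lambda>_. 0) k (real k)" "card P = 2 ^ k" by blast
  have "tree_graph (graph_of V W)" using tree_graph_of[OF V(1)] V(2) by blast
  moreover have "(2 :: nat) ^ 1 \<le> 2 ^ k" using \<open>0 < k\<close> by (intro power_increasing) auto
  then have "2 \<le> card P" using V(4) by simp
  moreover have "pverts (graph_of V W) = V" by simp
  ultimately show ?thesis
    using ex_coreset_instance[OF V(1,3) _ assms(2-4)] edge_weighted_graph_of[OF V(1)] V(4)
    unfolding tree_metric_def by metis
qed

lemma (in distance_table) planar_instance: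
  assumes "0 < k" "0 < \<epsilon>" "\<epsilon> < 1" "real k + real A / real (L - A) < 1 / \<epsilon>" "2 \<le> length ps"
  shows "\<exists>(V :: nat set) d P. planar_metric V d \<and> P \<subseteq> V \<and> P \<noteq> {} \<and>
    (\<forall>Q. kcenter_coreset V d k \<epsilon> P Q \<longrightarrow> card Q = length ps * 4 ^ (k - 1))"
proof -
  define D where "D = real (k - 1) + real A / real (L - A)"
  have hard0: "hard_points {..<n} scaled_weight (set ps) (\<lambda>_. k - 1) k D"
    using hard_points_scaled[of "k - 1"] \<open>0 < k\<close> unfolding D_def by simp
  \<comment> \<open>The center edges of a cube splitter have weight D - m - 1/2, which must be
    positive; m < k - 1 even gives D - m \<ge> 1.\<close>
  have large: "1 / 2 < D - real m" if "m < k - 1" for m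
  proof -
    have "real m + 1 \<le> real (k - 1)" using that by linarith
    moreover have "0 \<le> real A / real (L - A)" by simp
    moreover have "1 / 2 < x + y - z" if "z + 1 \<le> x" "0 \<le> y" for x y z :: real
      using that by linarith
    ultimately show ?thesis unfolding D_def by blast
  qed
  have split: "\<exists>V' W' S z. splitter V' W' p S z (D - real m) \<and> card S = 4 \<and> V \<inter> V' = {p} \<and>
      (\<exists>pos. straight_drawing (V \<union> V') (glue W W') pos)"
    if a: "net V W" "\<exists>pos. straight_drawing V W pos" "p \<in> V" "m < k - 1" for V :: "nat set" and W p m
  proof -
    obtain pos where "straight_drawing V W pos" using a(2) by blast
    from ex_cube_split[OF a(1) this a(3) large[OF a(4)]] show ?thesis .
  qed
  have draw0: "\<exists>pos. straight_drawing {..<n} scaled_weight pos" using straight_drawing_scaled by blast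
  from split_all_points[where Q = "\<lambda>V W. \<exists>pos. straight_drawing V W pos",
      OF split _ net_scaled draw0 hard0]
  have "\<exists>(V :: nat set) W P. net V W \<and> (\<exists>pos. straight_drawing V W pos) \<and>
      hard_points V W P (\<lambda>_. 0) k D \<and> card P = (\<Sum>p\<in>set ps. 4 ^ (k - 1))" by simp
  then obtain V :: "nat set" and W P where V: "net V W" "\<exists>pos. straight_drawing V W pos"
    "hard_points V W P (\<lambda>_. 0) k D" "card P = (\<Sum>p\<in>set ps. 4 ^ (k - 1))" by blast
  have P: "card P = length ps * 4 ^ (k - 1)" using V(4) card_points by simp
  have "2 * 1 \<le> card P" unfolding P using assms(5) by (intro mult_le_mono) auto
  moreover have "D + 1 < 1 / \<epsilon>" using assms(1,4) unfolding D_def by (simp add: of_nat_diff)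
  moreover have "planar_graph (graph_of V W)" using planar_graph_of[OF V(1)] V(2) by blast
  moreover have "pverts (graph_of V W) = V" by simp
  ultimately show ?thesis
    using ex_coreset_instance[OF V(1,3) _ assms(2,3)] edge_weighted_graph_of[OF V(1)] P
    unfolding planar_metric_def by (metis mult_1_right)
qed

text \<open>Taking q-th powers turns the bound at a rational exponent p / q into a comparison of
  integer powers.\<close>

lemma powr_le_if_power_le:
  fixes b N :: real
  assumes "0 < b" "0 < N" "0 < q" "b ^ p \<le> N ^ q" "x \<le> real p / real q" "1 \<le> b"
  shows "b powr x \<le> N"
proof -
  have "b powr x \<le> b powr (real p / real q)" using assms by (intro powr_mono) auto
  also have "\<dots> = (b ^ p) powr (1 / real q)"
    using assms(1) by (simp add: powr_powr flip: powr_realpow)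
  also have "\<dots> \<le> (N ^ q) powr (1 / real q)" using assms by (intro powr_mono2) auto
  also have "\<dots> = N" using assms(2,3) by (simp add: powr_powr flip: powr_realpow)
  finally show ?thesis .
qed

context
  fixes \<epsilon> :: real and k :: nat
  assumes \<epsilon>: "0 < \<epsilon>" "\<epsilon> < 1 / 2" and k: "k = nat (\<lceil>1 / \<epsilon>\<rceil> - 2)"
begin

text \<open>From \<epsilon> < 1/2 the ceiling is at least 3, so \<open>nat\<close> truncates nothing
  and k is positive.\<close>

lemma k_bounds: "0 < k" "real k + 1 < 1 / \<epsilon>" "1 / \<epsilon> \<le> real k + 2"
proof -
  have "2 < 1 / \<epsilon>" using \<epsilon> by (simp add: field_simps)
  then have "2 < \<lceil>1 / \<epsilon>\<rceil>" by (simp add: less_ceiling_iff)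
  then have "real k = of_int \<lceil>1 / \<epsilon>\<rceil> - 2" "0 < k" unfolding k by auto
  then show "0 < k" "real k + 1 < 1 / \<epsilon>" "1 / \<epsilon> \<le> real k + 2"
    using ceiling_correct[of "1 / \<epsilon>"] by linarith+
qed

lemma tree_coreset_lower_bound:
  "\<exists>(V :: nat set) d P. tree_metric V d \<and> P \<subseteq> V \<and> P \<noteq> {} \<and>
    (\<forall>Q. kcenter_coreset V d k \<epsilon> P Q \<longrightarrow> real (card Q) \<ge> 2 powr (1 / \<epsilon>) / 4)"
proof -
  have "2 powr (1 / \<epsilon>) \<le> 2 powr (real k + 2)" using k_bounds by (intro powr_mono) auto
  also have "\<dots> = 2 ^ k * 4" by (simp add: powr_add powr_realpow)
  finally have "2 powr (1 / \<epsilon>) / 4 \<le> real (2 ^ k)" by simp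
  moreover have "\<epsilon> < 1" using \<epsilon>(2) by simp
  ultimately show ?thesis using tree_instance[OF k_bounds(1) \<epsilon>(1) _ k_bounds(2)] by metis
qed

lemma planar_coreset_lower_bound_if_table:
  assumes "distance_table E xy ps xs T A L" and "2 \<le> length ps"
    and gap: "real A / real (L - A) < 1 / \<epsilon> - real k"
    and size: "4 powr (1 / \<epsilon> - real k) \<le> real (length ps)"
  shows "\<exists>(V :: nat set) d P. planar_metric V d \<and> P \<subseteq> V \<and> P \<noteq> {} \<and>
    (\<forall>Q. kcenter_coreset V d k \<epsilon> P Q \<longrightarrow> real (card Q) \<ge> 4 powr (1 / \<epsilon>) / 4)"
proof -
  interpret distance_table E xy ps xs T A L by fact
  have "4 powr (1 / \<epsilon>) = 4 powr (1 / \<epsilon> - real k) * 4 powr real k"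
    by (simp flip: powr_add)
  \<comment> \<open>The factor 4 split off last cancels against the division by 4 in the claim; what
    remains asks the first graph for 4 powr x points.\<close>
  also have "\<dots> = 4 powr (1 / \<epsilon> - real k) * 4 ^ (k - 1) * 4"
    using k_bounds(1) by (simp add: powr_realpow power_eq_if)
  also have "\<dots> \<le> real (length ps) * 4 ^ (k - 1) * 4"
    using size by (intro mult_right_mono) auto
  finally have "4 powr (1 / \<epsilon>) / 4 \<le> real (length ps * 4 ^ (k - 1))" by simp
  moreover have "real k + real A / real (L - A) < 1 / \<epsilon>" using gap by simp
  moreover have "\<epsilon> < 1" using \<epsilon>(2) by simp
  ultimately show ?thesis using planar_instance[OF k_bounds(1) \<epsilon>(1) _ _ assms(2)] by metis
qed

end

section \<open>Four planar graphs with antipodal points\<close>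

text \<open>The 8 points are the vertices of degree 3, those of a cube; the 6 vertices of degree 4
  stand for its faces. Two points with a common face have distance 2; only antipodes have none, and
  their distance is 4.\<close>

definition rhombic8_edges :: "(nat \<times> nat \<times> nat) list" where
  "rhombic8_edges = [
   (0, 1, 1), (0, 2, 1), (0, 3, 1), (1, 4, 1), (1, 5, 1), (1, 6, 1), (2, 4, 1), (2, 7, 1), (2, 8, 1),
   (3, 5, 1), (3, 7, 1), (3, 9, 1), (4, 10, 1), (5, 11, 1), (6, 10, 1), (6, 11, 1), (7, 12, 1),
   (8, 10, 1), (8, 12, 1), (9, 11, 1), (9, 12, 1), (10, 13, 1), (11, 13, 1), (12, 13, 1)]"

definition rhombic8_points :: "point list" where
  "rhombic8_points = [
   (10, 20), (9, 15), (20, 10), (0, 10), (15, 12), (5, 12), (10, 11), (10, 0), (15, 8), (6, 8),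
   (12, 10), (7, 10), (11, 5), (10, 8)]"

definition rhombic8_table :: "nat list list" where
  "rhombic8_table = [
   [4, 2, 2, 2, 2, 2, 2, 0], [3, 3, 3, 3, 1, 1, 1, 1], [3, 3, 1, 1, 3, 3, 1, 1],
   [3, 1, 3, 1, 3, 1, 3, 1], [2, 4, 2, 2, 2, 2, 0, 2], [2, 2, 4, 2, 2, 0, 2, 2],
   [2, 2, 2, 4, 0, 2, 2, 2], [2, 2, 2, 0, 4, 2, 2, 2], [2, 2, 0, 2, 2, 4, 2, 2],
   [2, 0, 2, 2, 2, 2, 4, 2], [1, 3, 1, 3, 1, 3, 1, 3], [1, 1, 3, 3, 1, 1, 3, 3],
   [1, 1, 1, 1, 3, 3, 3, 3], [0, 2, 2, 2, 2, 2, 2, 4]]"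

lemma grid_edges_rhombic8: "grid_edges (length rhombic8_table) rhombic8_edges"
  by code_simp

lemma drawn_rhombic8: "drawn rhombic8_points (map ends rhombic8_edges)"
  by code_simp

lemma lipschitz_rhombic8: "lipschitz_table rhombic8_table rhombic8_edges"
  by code_simp

lemma descending_rhombic8: "descending_table 
    [13, 9, 8, 7, 6, 5, 4, 0] rhombic8_table rhombic8_edges"
  by code_simp

text \<open>In this and the other three graphs the centers are the points themselves: the second
  list is the first with the members of each antipodal pair interchanged.\<close>

lemma separating_rhombic8: "separating_table 2 4 
    [0, 4, 5, 6, 7, 8, 9, 13] 
    [13, 9, 8, 7, 6, 5, 4, 0] rhombic8_table"
  by code_simp

lemma distance_table_rhombic8: "distance_table rhombic8_edges rhombic8_points 
    [0, 4, 5, 6, 7, 8, 9, 13] 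
    [13, 9, 8, 7, 6, 5, 4, 0] rhombic8_table 2 4"
proof
  show "length rhombic8_points = length rhombic8_table" by code_simp
qed (simp_all add: grid_edges_rhombic8 drawn_rhombic8 lipschitz_rhombic8 descending_rhombic8 separating_rhombic8)

definition antipodal12_edges :: "(nat \<times> nat \<times> nat) list" where
  "antipodal12_edges = [
   (0, 1, 1), (0, 2, 2), (0, 3, 2), (0, 4, 1), (1, 5, 1), (1, 6, 1), (2, 7, 1), (2, 8, 2), (3, 8, 2),
   (3, 9, 2), (4, 6, 1), (4, 7, 2), (4, 10, 2), (5, 9, 2), (5, 11, 2), (5, 12, 2), (6, 13, 2),
   (7, 14, 2), (7, 15, 1), (8, 16, 2), (8, 17, 1), (8, 18, 1), (9, 16, 2), (9, 19, 1), (10, 13, 1),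
   (10, 14, 2), (10, 20, 1), (11, 19, 1), (11, 21, 2), (12, 21, 2), (12, 22, 1), (13, 22, 1),
   (14, 23, 1), (14, 24, 1), (15, 18, 1), (15, 23, 2), (16, 25, 1), (17, 26, 1), (17, 27, 1),
   (18, 27, 1), (19, 25, 2), (19, 28, 2), (20, 24, 2), (20, 29, 2), (21, 28, 1), (21, 30, 1),
   (22, 29, 1), (23, 31, 2), (24, 31, 2), (24, 32, 2), (25, 26, 1), (25, 33, 2), (26, 34, 2),
   (27, 31, 2), (28, 33, 2), (28, 35, 1), (29, 30, 1), (29, 32, 2), (30, 35, 1), (31, 36, 1),
   (32, 37, 2), (33, 34, 1), (33, 37, 1), (34, 36, 1), (35, 37, 2), (36, 37, 1)]"

definition antipodal12_points :: "point list" where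
  "antipodal12_points = [
   (33, 58), (54, 29), (24, 45), (0, 47), (33, 40), (33, 0), (40, 31), (27, 39), (13, 36), (0, 11),
   (31, 32), (24, 10), (32, 13), (35, 27), (27, 34), (23, 36), (8, 24), (16, 31), (19, 35), (14, 15),
   (28, 28), (25, 15), (32, 21), (24, 33), (26, 29), (14, 22), (16, 26), (19, 32), (20, 18), (28, 23),
   (26, 19), (22, 30), (25, 25), (18, 22), (18, 25), (23, 20), (21, 27), (22, 24)]"

definition antipodal12_table :: "nat list list" where
  "antipodal12_table = [
   [4, 8, 8, 6, 2, 4, 2, 6, 6, 4, 2, 8], [3, 9, 7, 5, 3, 5, 1, 7, 7, 3, 3, 7],
   [6, 6, 10, 4, 0, 6, 4, 4, 4, 6, 4, 6], [4, 6, 6, 4, 4, 6, 4, 6, 4, 6, 0, 10],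
   [5, 9, 7, 7, 3, 3, 1, 5, 5, 5, 3, 7], [2, 8, 6, 4, 4, 6, 2, 8, 8, 2, 4, 6],
   [4, 10, 6, 6, 4, 4, 0, 6, 6, 4, 4, 6], [7, 7, 9, 5, 1, 5, 3, 3, 3, 7, 5, 5],
   [6, 4, 8, 2, 2, 8, 6, 4, 2, 8, 2, 8], [2, 6, 4, 2, 6, 8, 4, 8, 6, 4, 2, 8],
   [7, 7, 5, 9, 5, 1, 3, 3, 7, 3, 5, 5], [0, 6, 4, 4, 6, 6, 4, 10, 6, 4, 4, 6],
   [4, 6, 4, 6, 6, 4, 4, 6, 10, 0, 6, 4], [6, 8, 4, 8, 6, 2, 2, 4, 8, 2, 6, 4],
   [9, 5, 7, 7, 3, 3, 5, 1, 5, 5, 7, 3], [8, 6, 8, 4, 2, 6, 4, 2, 2, 8, 4, 6],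
   [4, 4, 6, 0, 4, 10, 6, 6, 4, 6, 4, 6], [5, 3, 7, 3, 3, 7, 7, 5, 1, 9, 3, 7],
   [7, 5, 7, 3, 3, 7, 5, 3, 1, 9, 3, 7], [1, 5, 3, 3, 7, 7, 5, 9, 5, 5, 3, 7],
   [6, 6, 4, 10, 6, 0, 4, 4, 6, 4, 6, 4], [2, 4, 2, 6, 8, 4, 6, 8, 8, 2, 6, 4],
   [5, 7, 3, 7, 7, 3, 3, 5, 9, 1, 7, 3], [10, 4, 6, 6, 4, 4, 6, 0, 4, 6, 6, 4],
   [8, 4, 6, 8, 4, 2, 6, 2, 4, 6, 8, 2], [3, 3, 5, 1, 5, 9, 7, 7, 3, 7, 5, 5],
   [4, 2, 6, 2, 4, 8, 8, 6, 2, 8, 4, 6], [6, 4, 6, 4, 4, 6, 6, 4, 0, 10, 4, 6],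
   [3, 3, 1, 5, 9, 5, 7, 7, 7, 3, 5, 5], [4, 6, 2, 8, 8, 2, 4, 6, 8, 2, 8, 2],
   [3, 5, 1, 7, 9, 3, 5, 7, 7, 3, 7, 3], [8, 2, 4, 6, 6, 4, 8, 2, 2, 8, 6, 4],
   [6, 4, 4, 6, 6, 4, 6, 4, 6, 4, 10, 0], [5, 1, 3, 3, 7, 7, 9, 5, 5, 5, 7, 3],
   [6, 0, 4, 4, 6, 6, 10, 4, 4, 6, 6, 4], [4, 4, 0, 6, 10, 4, 6, 6, 6, 4, 6, 4],
   [7, 1, 3, 5, 7, 5, 9, 3, 3, 7, 7, 3], [6, 2, 2, 4, 8, 6, 8, 4, 4, 6, 8, 2]]"

lemma grid_edges_antipodal12: "grid_edges (length antipodal12_table) antipodal12_edges"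
  by code_simp

lemma drawn_antipodal12: "drawn antipodal12_points (map ends antipodal12_edges)"
  by code_simp

lemma lipschitz_antipodal12: "lipschitz_table antipodal12_table antipodal12_edges"
  by code_simp

lemma descending_antipodal12: "descending_table 
    [11, 34, 35, 16, 2, 20, 6, 23, 27, 12, 3, 32] antipodal12_table antipodal12_edges"
  by code_simp

lemma separating_antipodal12: "separating_table 6 10 
    [23, 6, 2, 20, 35, 16, 34, 11, 12, 27, 32, 3] 
    [11, 34, 35, 16, 2, 20, 6, 23, 27, 12, 3, 32] antipodal12_table"
  by code_simp

lemma distance_table_antipodal12: "distance_table antipodal12_edges antipodal12_points 
    [23, 6, 2, 20, 35, 16, 34, 11, 12, 27, 32, 3] 
    [11, 34, 35, 16, 2, 20, 6, 23, 27, 12, 3, 32] antipodal12_table 6 10"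
proof
  show "length antipodal12_points = length antipodal12_table" by code_simp
qed (simp_all add: grid_edges_antipodal12 drawn_antipodal12 lipschitz_antipodal12 descending_antipodal12 separating_antipodal12)

definition antipodal14_edges :: "(nat \<times> nat \<times> nat) list" where
  "antipodal14_edges = [
   (0, 1, 1), (0, 2, 1), (0, 3, 3), (1, 4, 1), (1, 5, 2), (2, 6, 2), (2, 7, 2), (3, 8, 1), (3, 9, 1),
   (3, 10, 2), (4, 9, 2), (4, 11, 2), (5, 7, 2), (5, 12, 3), (5, 13, 2), (6, 8, 1), (6, 14, 1),
   (7, 15, 3), (7, 16, 1), (8, 17, 2), (9, 18, 2), (9, 19, 2), (10, 18, 1), (10, 20, 4), (10, 21, 3),
   (11, 12, 2), (11, 19, 2), (11, 22, 2), (12, 23, 2), (13, 15, 1), (13, 24, 2), (14, 25, 2),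
   (14, 26, 2), (15, 27, 1), (16, 26, 2), (16, 28, 2), (16, 29, 2), (17, 21, 2), (17, 25, 2),
   (18, 30, 2), (19, 30, 2), (19, 31, 2), (20, 21, 3), (20, 32, 1), (20, 33, 1), (21, 34, 1),
   (22, 23, 2), (22, 31, 2), (22, 35, 2), (23, 24, 1), (23, 36, 2), (24, 37, 1), (25, 38, 2),
   (25, 39, 2), (26, 39, 2), (27, 28, 1), (27, 37, 3), (27, 40, 4), (28, 41, 2), (29, 39, 2),
   (29, 41, 2), (29, 42, 2), (30, 32, 2), (30, 43, 2), (31, 43, 2), (32, 44, 2), (33, 45, 1),
   (33, 46, 3), (34, 38, 1), (34, 45, 2), (35, 36, 2), (35, 43, 2), (35, 47, 2), (36, 48, 1),
   (37, 40, 3), (37, 49, 2), (38, 50, 2), (38, 51, 2), (39, 51, 2), (40, 52, 2), (40, 53, 1),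
   (41, 53, 2), (41, 54, 2), (42, 51, 2), (42, 54, 2), (43, 44, 2), (44, 46, 1), (44, 47, 2),
   (45, 55, 2), (46, 55, 2), (46, 56, 2), (47, 57, 3), (48, 49, 1), (48, 57, 2), (49, 58, 2),
   (50, 55, 3), (50, 59, 2), (51, 59, 2), (52, 58, 1), (52, 60, 3), (52, 61, 1), (53, 61, 2),
   (54, 59, 2), (54, 61, 2), (55, 62, 2), (56, 57, 2), (56, 60, 1), (57, 58, 1), (59, 63, 2),
   (60, 62, 1), (61, 63, 2), (62, 63, 1)]"

definition antipodal14_points :: "point list" where
  "antipodal14_points = [
   (85, 70), (92, 70), (79, 76), (82, 62), (96, 62), (94, 79), (75, 72), (77, 84), (76, 66), (89, 57),
   (78, 55), (104, 56), (111, 66), (88, 96), (70, 73), (70, 95), (65, 83), (71, 63), (83, 52),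
   (94, 49), (72, 50), (71, 57), (107, 42), (130, 56), (98, 112), (67, 68), (67, 77), (50, 99),
   (55, 89), (58, 79), (84, 44), (96, 41), (75, 43), (64, 48), (65, 58), (88, 22), (98, 0), (33, 112),
   (62, 63), (62, 73), (36, 90), (51, 82), (55, 74), (84, 35), (69, 35), (62, 53), (58, 42), (65, 25),
   (32, 0), (0, 56), (56, 60), (58, 69), (34, 67), (43, 82), (50, 74), (55, 53), (47, 40), (42, 26),
   (24, 51), (53, 66), (42, 54), (43, 72), (48, 57), (47, 64)]"

definition antipodal14_table :: "nat list list" where
  "antipodal14_table = [
   [16, 6, 6, 0, 10, 10, 10, 6, 10, 6, 10, 6, 8, 8], [15, 7, 5, 1, 9, 11, 11, 7, 11, 5, 9, 5, 9, 7],
   [15, 5, 5, 1, 11, 11, 9, 5, 9, 7, 11, 7, 7, 9], [13, 3, 9, 3, 13, 7, 9, 5, 13, 7, 11, 3, 11, 5],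
   [14, 6, 6, 2, 10, 10, 12, 8, 12, 4, 8, 4, 10, 6], [13, 9, 3, 3, 7, 13, 13, 5, 9, 3, 11, 7, 7, 9],
   [13, 3, 7, 3, 13, 9, 7, 3, 11, 9, 13, 5, 9, 7], [13, 7, 3, 3, 9, 13, 11, 3, 7, 5, 13, 9, 5, 11],
   [12, 2, 8, 4, 14, 8, 8, 4, 12, 8, 12, 4, 10, 6], [12, 4, 8, 4, 12, 8, 10, 6, 14, 6, 10, 2, 12, 4],
   [11, 5, 11, 5, 11, 5, 7, 7, 15, 9, 9, 1, 9, 7], [12, 8, 8, 4, 8, 8, 14, 10, 10, 2, 6, 6, 12, 4],
   [10, 10, 6, 6, 6, 10, 16, 8, 8, 0, 8, 8, 10, 6], [11, 11, 1, 5, 5, 15, 11, 7, 7, 5, 9, 9, 9, 7],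
   [12, 4, 8, 4, 12, 8, 6, 2, 10, 10, 14, 6, 8, 8], [10, 10, 0, 6, 6, 16, 10, 6, 6, 6, 10, 10, 8, 8],
   [12, 8, 4, 4, 8, 12, 10, 2, 6, 6, 14, 10, 4, 12], [10, 0, 10, 6, 16, 6, 6, 6, 10, 10, 10, 6, 8, 8],
   [10, 6, 10, 6, 10, 6, 8, 8, 16, 8, 8, 0, 10, 6], [10, 6, 10, 6, 10, 6, 12, 8, 12, 4, 8, 4, 14, 2],
   [7, 5, 15, 9, 11, 1, 7, 11, 11, 9, 5, 5, 9, 7], [8, 2, 12, 8, 14, 4, 4, 8, 12, 12, 8, 4, 6, 10],
   [10, 10, 6, 6, 6, 10, 12, 12, 8, 4, 4, 8, 14, 2], [8, 12, 4, 8, 4, 12, 14, 10, 6, 2, 6, 10, 12, 4],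
   [9, 13, 3, 7, 3, 13, 13, 9, 5, 3, 7, 11, 11, 5], [10, 2, 10, 6, 14, 6, 4, 4, 8, 12, 12, 8, 6, 10],
   [10, 6, 6, 6, 10, 10, 8, 0, 8, 8, 16, 8, 6, 10], [9, 11, 1, 7, 5, 15, 9, 5, 5, 7, 11, 11, 7, 9],
   [10, 10, 2, 6, 6, 14, 8, 4, 4, 8, 12, 12, 6, 10], [10, 6, 6, 6, 10, 10, 8, 4, 4, 8, 12, 12, 2, 14],
   [8, 8, 12, 8, 8, 4, 10, 10, 14, 6, 6, 2, 12, 4], [8, 8, 8, 8, 8, 8, 10, 10, 10, 6, 6, 6, 16, 0],
   [6, 6, 14, 10, 10, 2, 8, 12, 12, 8, 4, 4, 10, 6], [6, 6, 16, 10, 10, 0, 6, 10, 10, 10, 6, 6, 8, 8],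
   [7, 3, 13, 9, 13, 3, 3, 7, 11, 13, 9, 5, 5, 11], [8, 12, 8, 8, 4, 8, 10, 14, 10, 6, 2, 6, 12, 4],
   [6, 14, 6, 10, 2, 10, 12, 12, 8, 4, 4, 8, 10, 6], [8, 14, 4, 8, 2, 12, 12, 8, 4, 4, 8, 12, 10, 6],
   [8, 4, 12, 8, 12, 4, 2, 6, 10, 14, 10, 6, 4, 12], [8, 4, 8, 8, 12, 8, 6, 2, 6, 10, 14, 10, 4, 12],
   [5, 11, 5, 11, 5, 11, 9, 9, 1, 7, 7, 15, 7, 9], [8, 8, 4, 8, 8, 12, 6, 6, 2, 10, 10, 14, 4, 12],
   [8, 8, 8, 8, 8, 8, 6, 6, 6, 10, 10, 10, 0, 16], [6, 10, 10, 10, 6, 6, 8, 12, 12, 8, 4, 4, 14, 2],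
   [4, 8, 12, 12, 8, 4, 6, 14, 10, 10, 2, 6, 12, 4], [5, 5, 15, 11, 11, 1, 5, 9, 9, 11, 7, 7, 7, 9],
   [3, 9, 13, 13, 7, 3, 5, 13, 9, 11, 3, 7, 11, 5], [6, 10, 10, 10, 6, 6, 8, 16, 8, 8, 0, 8, 10, 6],
   [5, 15, 7, 11, 1, 9, 11, 11, 7, 5, 5, 9, 9, 7], [6, 16, 6, 10, 0, 10, 10, 10, 6, 6, 6, 10, 8, 8],
   [6, 6, 10, 10, 10, 6, 0, 8, 8, 16, 8, 8, 6, 10], [6, 6, 10, 10, 10, 6, 4, 4, 8, 12, 12, 8, 2, 14],
   [3, 13, 7, 13, 3, 9, 7, 11, 3, 9, 5, 13, 5, 11], [6, 10, 6, 10, 6, 10, 8, 8, 0, 8, 8, 16, 6, 10],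
   [6, 10, 6, 10, 6, 10, 4, 8, 4, 12, 8, 12, 2, 14], [3, 7, 13, 13, 9, 3, 3, 11, 7, 13, 5, 9, 9, 7],
   [1, 11, 11, 15, 5, 5, 7, 11, 7, 9, 5, 9, 9, 7], [3, 13, 9, 13, 3, 7, 9, 13, 5, 7, 3, 11, 7, 9],
   [4, 14, 8, 12, 2, 8, 8, 12, 4, 8, 4, 12, 6, 10], [4, 8, 8, 12, 8, 8, 2, 6, 6, 14, 10, 10, 4, 12],
   [0, 10, 10, 16, 6, 6, 6, 10, 6, 10, 6, 10, 8, 8], [4, 12, 8, 12, 4, 8, 6, 10, 2, 10, 6, 14, 4, 12],
   [1, 9, 11, 15, 7, 5, 5, 9, 5, 11, 7, 11, 7, 9], [2, 10, 10, 14, 6, 6, 4, 8, 4, 12, 8, 12, 6, 10]]"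

lemma grid_edges_antipodal14: "grid_edges (length antipodal14_table) antipodal14_edges"
  by code_simp

lemma drawn_antipodal14: "drawn antipodal14_points (map ends antipodal14_edges)"
  by code_simp

lemma lipschitz_antipodal14: "lipschitz_table antipodal14_table antipodal14_edges"
  by code_simp

lemma descending_antipodal14: "descending_table 
    [60, 17, 15, 0, 49, 33, 50, 26, 53, 12, 47, 18, 42, 31] antipodal14_table antipodal14_edges"
  by code_simp

lemma separating_antipodal14: "separating_table 10 16 
    [0, 49, 33, 60, 17, 15, 12, 47, 18, 50, 26, 53, 31, 42] 
    [60, 17, 15, 0, 49, 33, 50, 26, 53, 12, 47, 18, 42, 31] antipodal14_table"
  by code_simp

lemma distance_table_antipodal14: "distance_table antipodal14_edges antipodal14_points 
    [0, 49, 33, 60, 17, 15, 12, 47, 18, 50, 26, 53, 31, 42] 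
    [60, 17, 15, 0, 49, 33, 50, 26, 53, 12, 47, 18, 42, 31] antipodal14_table 10 16"
proof
  show "length antipodal14_points = length antipodal14_table" by code_simp
qed (simp_all add: grid_edges_antipodal14 drawn_antipodal14 lipschitz_antipodal14 descending_antipodal14 separating_antipodal14)

definition antipodal16_edges :: "(nat \<times> nat \<times> nat) list" where
  "antipodal16_edges = [
   (0, 1, 1), (0, 2, 3), (0, 3, 3), (1, 4, 3), (1, 5, 4), (1, 6, 4), (2, 7, 4), (2, 8, 3), (3, 9, 4),
   (3, 10, 3), (4, 8, 4), (4, 11, 4), (4, 12, 4), (5, 9, 4), (5, 13, 1), (6, 12, 3), (6, 14, 5),
   (6, 15, 4), (7, 16, 7), (7, 17, 5), (7, 18, 3), (8, 19, 4), (9, 20, 4), (9, 21, 3), (10, 18, 4),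
   (10, 21, 4), (11, 22, 3), (11, 23, 3), (11, 24, 4), (12, 24, 4), (12, 25, 5), (13, 15, 3),
   (14, 25, 3), (14, 26, 4), (15, 26, 5), (15, 27, 3), (16, 19, 4), (16, 28, 3), (16, 29, 4),
   (17, 28, 5), (17, 30, 3), (18, 30, 5), (18, 31, 4), (19, 22, 1), (20, 27, 1), (20, 32, 5),
   (20, 33, 3), (21, 31, 4), (21, 33, 4), (22, 34, 3), (23, 34, 3), (23, 35, 2), (24, 36, 5),
   (25, 37, 2), (26, 38, 3), (26, 39, 5), (27, 38, 5), (28, 40, 5), (28, 41, 3), (29, 34, 4),
   (29, 42, 5), (30, 41, 5), (30, 43, 4), (31, 44, 4), (31, 45, 3), (32, 46, 4), (32, 47, 4),
   (33, 44, 4), (33, 47, 6), (34, 48, 6), (35, 36, 4), (35, 49, 3), (36, 37, 2), (36, 50, 3),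
   (37, 39, 4), (38, 46, 3), (38, 51, 5), (39, 51, 3), (39, 52, 5), (40, 42, 1), (40, 53, 3),
   (41, 53, 5), (41, 54, 4), (42, 48, 3), (42, 55, 3), (43, 45, 2), (43, 54, 5), (43, 56, 5),
   (44, 57, 3), (45, 57, 4), (45, 58, 5), (46, 59, 4), (46, 60, 7), (47, 61, 3), (47, 62, 3),
   (48, 49, 4), (48, 63, 4), (49, 50, 4), (50, 52, 4), (50, 63, 4), (51, 60, 5), (52, 60, 3),
   (52, 64, 4), (53, 65, 4), (53, 66, 3), (54, 65, 5), (55, 66, 4), (55, 67, 1), (56, 58, 2),
   (56, 68, 2), (57, 62, 2), (58, 69, 4), (59, 61, 1), (59, 70, 4), (60, 71, 4), (61, 69, 3),
   (62, 69, 3), (63, 64, 4), (63, 67, 3), (64, 72, 3), (65, 68, 3), (65, 73, 3), (66, 73, 4),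
   (67, 72, 4), (68, 74, 4), (69, 74, 4), (70, 71, 3), (70, 74, 4), (71, 75, 3), (72, 75, 3),
   (73, 76, 1), (74, 76, 3), (75, 76, 1)]"

definition antipodal16_points :: "point list" where
  "antipodal16_points = [
   (73, 71), (65, 76), (74, 62), (77, 77), (60, 68), (68, 84), (58, 83), (81, 57), (67, 60), (74, 87),
   (83, 75), (53, 62), (54, 76), (64, 89), (53, 90), (60, 93), (74, 44), (90, 54), (89, 68), (67, 51),
   (72, 98), (83, 85), (58, 52), (48, 56), (48, 71), (49, 84), (52, 98), (64, 100), (88, 43), (63, 36),
   (99, 63), (91, 80), (72, 109), (82, 96), (52, 44), (41, 64), (40, 77), (42, 88), (57, 107),
   (42, 99), (85, 30), (104, 51), (59, 23), (107, 76), (89, 91), (100, 87), (63, 116), (83, 107),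
   (40, 42), (36, 60), (30, 78), (48, 109), (33, 103), (111, 39), (114, 66), (54, 0), (111, 91),
   (95, 95), (104, 99), (78, 121), (48, 120), (87, 115), (93, 105), (20, 60), (18, 95), (127, 72),
   (122, 15), (0, 43), (118, 97), (101, 112), (84, 129), (60, 136), (0, 113), (152, 78), (108, 123),
   (54, 156), (122, 141)]"

definition antipodal16_table :: "nat list list" where
  "antipodal16_table = [
   [16, 18, 28, 6, 28, 6, 6, 28, 24, 10, 16, 18, 12, 22, 22, 12],
   [15, 19, 27, 7, 27, 7, 5, 29, 25, 9, 17, 17, 13, 21, 23, 11],
   [19, 15, 25, 9, 31, 3, 9, 25, 21, 13, 19, 15, 9, 25, 19, 15],
   [19, 15, 31, 3, 25, 9, 9, 25, 21, 13, 13, 21, 15, 19, 19, 15],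
   [12, 22, 24, 10, 30, 4, 8, 26, 22, 12, 20, 14, 16, 18, 26, 8],
   [19, 15, 23, 11, 23, 11, 1, 33, 21, 13, 13, 21, 17, 17, 19, 15],
   [19, 15, 23, 11, 23, 11, 7, 27, 29, 5, 13, 21, 17, 17, 27, 7],
   [23, 11, 27, 7, 27, 7, 13, 21, 17, 17, 23, 11, 5, 29, 15, 19],
   [16, 18, 22, 12, 34, 0, 12, 22, 18, 16, 22, 12, 12, 22, 22, 12],
   [23, 11, 27, 7, 21, 13, 5, 29, 17, 17, 9, 25, 19, 15, 15, 19],
   [22, 12, 34, 0, 22, 12, 12, 22, 18, 16, 16, 18, 12, 22, 16, 18],
   [8, 26, 20, 14, 26, 8, 12, 22, 18, 16, 24, 10, 16, 18, 30, 4],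
   [16, 18, 20, 14, 26, 8, 10, 24, 26, 8, 16, 18, 20, 14, 30, 4],
   [20, 14, 22, 12, 22, 12, 0, 34, 22, 12, 12, 22, 18, 16, 20, 14],
   [14, 20, 18, 16, 18, 16, 12, 22, 34, 0, 14, 20, 22, 12, 22, 12],
   [23, 11, 19, 15, 19, 15, 3, 31, 25, 9, 9, 25, 21, 13, 23, 11],
   [16, 18, 20, 14, 26, 8, 20, 14, 10, 24, 30, 4, 8, 26, 22, 12],
   [18, 16, 22, 12, 22, 12, 18, 16, 12, 22, 22, 12, 0, 34, 14, 20],
   [26, 8, 30, 4, 24, 10, 16, 18, 14, 20, 20, 14, 8, 26, 12, 22],
   [12, 22, 18, 16, 30, 4, 16, 18, 14, 20, 26, 8, 12, 22, 26, 8],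
   [27, 7, 23, 11, 17, 17, 7, 27, 21, 13, 5, 29, 23, 11, 19, 15],
   [26, 8, 30, 4, 18, 16, 8, 26, 14, 20, 12, 22, 16, 18, 12, 22],
   [11, 23, 17, 17, 29, 5, 15, 19, 15, 19, 27, 7, 13, 21, 27, 7],
   [5, 29, 17, 17, 23, 11, 15, 19, 21, 13, 27, 7, 19, 15, 27, 7],
   [12, 22, 16, 18, 22, 12, 14, 20, 22, 12, 20, 14, 20, 14, 34, 0],
   [11, 23, 15, 19, 21, 13, 15, 19, 31, 3, 17, 17, 25, 9, 25, 9],
   [18, 16, 14, 20, 14, 20, 8, 26, 30, 4, 10, 24, 26, 8, 18, 16],
   [26, 8, 22, 12, 16, 18, 6, 28, 22, 12, 6, 28, 24, 10, 20, 14],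
   [13, 21, 17, 17, 23, 11, 23, 11, 7, 27, 27, 7, 5, 29, 19, 15],
   [12, 22, 16, 18, 22, 12, 22, 12, 14, 20, 34, 0, 12, 22, 20, 14],
   [21, 13, 25, 9, 19, 15, 21, 13, 9, 25, 19, 15, 3, 31, 11, 23],
   [30, 4, 26, 8, 20, 14, 12, 22, 10, 24, 16, 18, 12, 22, 8, 26],
   [22, 12, 18, 16, 12, 22, 12, 22, 20, 14, 0, 34, 22, 12, 14, 20],
   [30, 4, 26, 8, 14, 20, 10, 24, 18, 16, 8, 26, 20, 14, 16, 18],
   [8, 26, 14, 20, 26, 8, 18, 16, 18, 16, 30, 4, 16, 18, 24, 10],
   [3, 31, 15, 19, 21, 13, 17, 17, 23, 11, 25, 9, 21, 13, 25, 9],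
   [7, 27, 11, 23, 17, 17, 19, 15, 27, 7, 21, 13, 25, 9, 29, 5],
   [9, 25, 13, 21, 19, 15, 17, 17, 29, 5, 19, 15, 27, 7, 27, 7],
   [21, 13, 17, 17, 11, 23, 11, 23, 27, 7, 7, 27, 29, 5, 15, 19],
   [13, 21, 9, 25, 15, 19, 13, 21, 25, 9, 15, 19, 31, 3, 23, 11],
   [8, 26, 12, 22, 18, 16, 28, 6, 12, 22, 28, 6, 10, 24, 14, 20],
   [16, 18, 20, 14, 20, 14, 26, 8, 4, 30, 24, 10, 8, 26, 16, 18],
   [7, 27, 11, 23, 17, 17, 27, 7, 13, 21, 29, 5, 11, 23, 15, 19],
   [25, 9, 21, 13, 15, 19, 17, 17, 5, 29, 15, 19, 7, 27, 7, 27],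
   [34, 0, 22, 12, 16, 18, 14, 20, 14, 20, 12, 22, 16, 18, 12, 22],
   [27, 7, 23, 11, 17, 17, 15, 19, 7, 27, 13, 21, 9, 25, 5, 29],
   [18, 16, 14, 20, 8, 26, 14, 20, 24, 10, 4, 30, 26, 8, 12, 22],
   [26, 8, 20, 14, 8, 26, 16, 18, 16, 18, 4, 30, 18, 16, 10, 24],
   [4, 30, 8, 26, 20, 14, 24, 10, 16, 18, 26, 8, 14, 20, 18, 16],
   [0, 34, 12, 22, 18, 16, 20, 14, 20, 14, 22, 12, 18, 16, 22, 12],
   [4, 30, 8, 26, 14, 20, 22, 12, 24, 10, 18, 16, 22, 12, 26, 8],
   [16, 18, 12, 22, 12, 22, 16, 18, 22, 12, 12, 22, 34, 0, 20, 14],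
   [8, 26, 4, 30, 10, 24, 18, 16, 20, 14, 14, 20, 26, 8, 22, 12],
   [11, 23, 15, 19, 15, 19, 31, 3, 9, 25, 25, 9, 13, 21, 11, 23],
   [20, 14, 16, 18, 16, 18, 22, 12, 0, 34, 20, 14, 12, 22, 12, 22],
   [10, 24, 8, 26, 14, 20, 30, 4, 16, 18, 26, 8, 14, 20, 18, 16],
   [20, 14, 16, 18, 10, 24, 22, 12, 10, 24, 16, 18, 12, 22, 2, 32],
   [31, 3, 19, 15, 13, 21, 17, 17, 11, 23, 9, 25, 13, 21, 9, 25],
   [22, 12, 18, 16, 12, 22, 20, 14, 12, 22, 14, 20, 14, 20, 0, 34],
   [22, 12, 16, 18, 4, 30, 18, 16, 20, 14, 8, 26, 22, 12, 8, 26],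
   [11, 23, 7, 27, 7, 27, 21, 13, 17, 17, 11, 23, 29, 5, 19, 15],
   [23, 11, 17, 17, 5, 29, 19, 15, 19, 15, 7, 27, 21, 13, 7, 27],
   [29, 5, 17, 17, 11, 23, 19, 15, 13, 21, 7, 27, 15, 19, 7, 27],
   [8, 26, 4, 30, 16, 18, 26, 8, 20, 14, 22, 12, 18, 16, 22, 12],
   [12, 22, 0, 34, 12, 22, 22, 12, 16, 18, 18, 16, 22, 12, 18, 16],
   [15, 19, 11, 23, 11, 23, 27, 7, 5, 29, 21, 13, 17, 17, 7, 27],
   [14, 20, 12, 22, 12, 22, 34, 0, 12, 22, 22, 12, 16, 18, 14, 20],
   [11, 23, 7, 27, 13, 21, 29, 5, 17, 17, 25, 9, 15, 19, 19, 15],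
   [18, 16, 14, 20, 8, 26, 24, 10, 8, 26, 18, 16, 14, 20, 4, 30],
   [26, 8, 14, 20, 8, 26, 22, 12, 16, 18, 10, 24, 18, 16, 4, 30],
   [18, 16, 12, 22, 0, 34, 22, 12, 16, 18, 12, 22, 22, 12, 12, 22],
   [15, 19, 9, 25, 3, 31, 25, 9, 13, 21, 15, 19, 25, 9, 15, 19],
   [15, 19, 3, 31, 9, 25, 25, 9, 13, 21, 21, 13, 19, 15, 15, 19],
   [18, 16, 8, 26, 8, 26, 30, 4, 8, 26, 18, 16, 20, 14, 10, 24],
   [22, 12, 10, 24, 4, 30, 26, 8, 12, 22, 14, 20, 18, 16, 8, 26],
   [18, 16, 6, 28, 6, 28, 28, 6, 10, 24, 18, 16, 22, 12, 12, 22],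
   [19, 15, 7, 27, 7, 27, 29, 5, 9, 25, 17, 17, 21, 13, 11, 23]]"

lemma grid_edges_antipodal16: "grid_edges (length antipodal16_table) antipodal16_edges"
  by code_simp

lemma drawn_antipodal16: "drawn antipodal16_points (map ends antipodal16_edges)"
  by code_simp

lemma lipschitz_antipodal16: "lipschitz_table antipodal16_table antipodal16_edges"
  by code_simp

lemma descending_antipodal16: "descending_table 
    [49, 44, 64, 10, 70, 8, 13, 66, 54, 14, 32, 29, 17, 51, 58, 24] antipodal16_table antipodal16_edges"
  by code_simp

lemma separating_antipodal16: "separating_table 22 34 
    [44, 49, 10, 64, 8, 70, 66, 13, 14, 54, 29, 32, 51, 17, 24, 58] 
    [49, 44, 64, 10, 70, 8, 13, 66, 54, 14, 32, 29, 17, 51, 58, 24] antipodal16_table"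
  by code_simp

lemma distance_table_antipodal16: "distance_table antipodal16_edges antipodal16_points 
    [44, 49, 10, 64, 8, 70, 66, 13, 14, 54, 29, 32, 51, 17, 24, 58] 
    [49, 44, 64, 10, 70, 8, 13, 66, 54, 14, 32, 29, 17, 51, 58, 24] antipodal16_table 22 34"
proof
  show "length antipodal16_points = length antipodal16_table" by code_simp
qed (simp_all add: grid_edges_antipodal16 drawn_antipodal16 lipschitz_antipodal16 descending_antipodal16 separating_antipodal16)

theorem theorem1p11:
  fixes \<epsilon> :: real and k :: nat
  assumes "0 < \<epsilon>" and "\<epsilon> < 1 / 2"
    and "k = nat (\<lceil>1 / \<epsilon>\<rceil> - 2)"
  shows "(\<exists>(V :: nat set) d P. tree_metric V d \<and> P \<subseteq> V \<and> P \<noteq> {} \<and>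
            (\<forall>Q. kcenter_coreset V d k \<epsilon> P Q \<longrightarrow> real (card Q) \<ge> 2 powr (1 / \<epsilon>) / 4))
       \<and> (\<exists>(V :: nat set) d P. planar_metric V d \<and> P \<subseteq> V \<and> P \<noteq> {} \<and>
            (\<forall>Q. kcenter_coreset V d k \<epsilon> P Q \<longrightarrow> real (card Q) \<ge> 4 powr (1 / \<epsilon>) / 4))"
proof (rule conjI)
  show "\<exists>(V :: nat set) d P. tree_metric V d \<and> P \<subseteq> V \<and> P \<noteq> {} \<and>
      (\<forall>Q. kcenter_coreset V d k \<epsilon> P Q \<longrightarrow> real (card Q) \<ge> 2 powr (1 / \<epsilon>) / 4)"
    by (rule tree_coreset_lower_bound[OF assms])
  define x where "x = 1 / \<epsilon> - real k"
  have x: "1 < x" "x \<le> 2"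
    using k_bounds[OF assms] unfolding x_def by linarith+
  note lower = planar_coreset_lower_bound_if_table[OF assms, folded x_def]
  \<comment> \<open>The four graphs have A / (L - A) = 1, 3/2, 5/3, 11/6, in each case below x. At
    the right ends 3/2, 7/4, 15/8, 2 the condition 4 powr x \<le> N becomes 4 ^ 3 \<le> 8 ^ 2, 4 ^ 7
    \<le> 12 ^ 4, 4 ^ 15 \<le> 14 ^ 8 and 4 ^ 2 \<le> 16.\<close>
  consider "x \<le> 3 / 2" | "3 / 2 < x" "x \<le> 7 / 4" | "7 / 4 < x" "x \<le> 15 / 8" | "15 / 8 < x"
    by linarith
  then show "\<exists>(V :: nat set) d P. planar_metric V d \<and> P \<subseteq> V \<and> P \<noteq> {} \<and>
      (\<forall>Q. kcenter_coreset V d k \<epsilon> P Q \<longrightarrow> real (card Q) \<ge> 4 powr (1 / \<epsilon>) / 4)"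
  proof cases
    case 1
    show ?thesis
      by (rule lower[OF distance_table_rhombic8])
        (use x 1 powr_le_if_power_le[of 4 8 2 3 x] in simp_all)
  next
    case 2
    show ?thesis
      by (rule lower[OF distance_table_antipodal12])
        (use 2 powr_le_if_power_le[of 4 12 4 7 x] in simp_all)
  next
    case 3
    show ?thesis
      by (rule lower[OF distance_table_antipodal14])
        (use 3 powr_le_if_power_le[of 4 14 8 15 x] in simp_all)
  next
    case 4
    show ?thesis
      by (rule lower[OF distance_table_antipodal16])
        (use x 4 powr_le_if_power_le[of 4 16 1 2 x] in simp_all)
  qed
qed

end
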